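(* For a greedy policy and an alternating policy applied to the same label sequences, with match counts $M_{\mathbf G}(n)$ and $M_{\mathbf A}(n)$, $$\frac{M_{\mathbf G}(n)-M_{\mathbf A}(n)}{n^{5/4}}\xrightarrow{d}\mathbf F\qquad(n\to\infty),$$ where $\mathbf F=\int \mathrm N(0,\sigma^2)\,dG(\sigma^2)$ is the scale mixture of centered normals in which the mixing distribution $G$ of the variance $\sigma^2$ is the law of $|W|$ with $W\sim\mathrm N\bigl(0,\frac{(\sigma_{\mathbf R}^2+\sigma_{\mathbf S}^2)^3}{128\mu^2}\bigr)$.
   Context: Let $(r_i)_{i\ge1}$, $(s_i)_{i\ge1}$ be probability vectors on the positive integers with $\mu:=\sum_i r_is_i>0$. Let $\{L_{\mathbf R}(n)\}_{n\ge1}$, $\{L_{\mathbf S}(n)\}_{n\ge1}$ be independent i.i.d. sequences with $\Pr(L_{\mathbf R}(1)=i)=r_i$, $\Pr(L_{\mathbf S}(1)=i)=s_i$. For $m\ge0$ let $\tilde N_{\mathbf R}(m)$ be the vector with entries $N_{\mathbf R}(m,i)=\sum_{j=1}^m\mathbf 1\{L_{\mathbf R}(j)=i\}$, and $\tilde N_{\mathbf S}(m)$ analogously. Put $X_{\mathbf R}(n)=s_{L_{\mathbf R}(n)}$, $X_{\mathbf S}(n)=r_{L_{\mathbf S}(n)}$ (common mean $\mu$, variances $\sigma_{\mathbf R}^2,\sigma_{\mathbf S}^2$; standing assumption $\sigma_{\mathbf R}+\sigma_{\mathbf S}>0$), $\Gamma_{\mathbf R}[m]=\sum_{j=1}^mX_{\mathbf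 R}(j)$, $\Gamma_{\mathbf S}[m]=\sum_{j=1}^mX_{\mathbf S}(j)$. A reading policy is a $\{0,1\}$-valued process $C(n)$ ($C(n)=1$ iff the $n$-th record is read from $\mathbf R$), $R(n)=\sum_{j\le n}C(j)$, $S(n)=n-R(n)$, with $C(n)$ being $\mathcal F_{n-1}$-measurable where $\mathcal F_n=\mathcal F_0\vee\sigma(L_{\mathbf R}(1),\dots,L_{\mathbf R}(R(n));L_{\mathbf S}(1),\dots,L_{\mathbf S}(S(n)))$ and $\mathcal F_0$ (randomization, for both policies) is independent of the labels. Matches: $M(n)=\tilde N_{\mathbf R}(R(n))\cdot\tilde N_{\mathbf S}(S(n))$. An alternating policy is $\mathcal F_0$-measurable with $R(2n)=n$ for all $n$. A greedy policy satisfies, for $n\ge1$, $C(n+1)=1$ if $\Gamma_{\mathbf S}[S(n)]>\Gamma_{\mathbf R}[R(n)]$ and $C(n+1)=0$ if $\Gamma_{\mathbf S}[S(n)]<\Gamma_{\mathbf R}[R(n)]$ (ties arbitrary). *)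

theory Defs
  imports "HOL-Probability.Probability"
begin

(* Labels: LR, LS :: nat => 'a => nat, only indices n >= 1 are used.
   A reading policy C :: nat => 'a => bool; C n w = True iff the n-th record (n >= 1) is read from R. *)

definition Rcnt :: "(nat \<Rightarrow> 'a \<Rightarrow> bool) \<Rightarrow> nat \<Rightarrow> 'a \<Rightarrow> nat" where
  "Rcnt C n w = card {j \<in> {1..n}. C j w}"

definition Scnt :: "(nat \<Rightarrow> 'a \<Rightarrow> bool) \<Rightarrow> nat \<Rightarrow> 'a \<Rightarrow> nat" where
  "Scnt C n w = n - Rcnt C n w"

definition Ncnt :: "(nat \<Rightarrow> 'a \<Rightarrow> nat) \<Rightarrow> nat \<Rightarrow> nat \<Rightarrow> 'a \<Rightarrow> nat" where
  "Ncnt L m i w = card {j \<in> {1..m}. L j w = i}"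

definition Gam :: "(nat \<Rightarrow> real) \<Rightarrow> (nat \<Rightarrow> 'a \<Rightarrow> nat) \<Rightarrow> nat \<Rightarrow> 'a \<Rightarrow> real" where
  "Gam f L m w = (\<Sum>j=1..m. f (L j w))"

(* M(n) = N_R(R(n)) . N_S(S(n)); only finitely many nonzero terms *)
definition matches :: "(nat \<Rightarrow> 'a \<Rightarrow> nat) \<Rightarrow> (nat \<Rightarrow> 'a \<Rightarrow> nat) \<Rightarrow> (nat \<Rightarrow> 'a \<Rightarrow> bool) \<Rightarrow> nat \<Rightarrow> 'a \<Rightarrow> nat" where
  "matches LR LS C n w =
     (\<Sum>i \<in> {i. 0 < Ncnt LR (Rcnt C n w) i w}.
        Ncnt LR (Rcnt C n w) i w * Ncnt LS (Scnt C n w) i w)"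

(* F_n = F_0 \<or> sigma(L_R(1..R(n)), L_S(1..S(n))): generated by F_0 and the
   label sequences stopped at the random times R(n), S(n). *)
definition info :: "'a measure \<Rightarrow> 'a set set \<Rightarrow> (nat \<Rightarrow> 'a \<Rightarrow> nat) \<Rightarrow> (nat \<Rightarrow> 'a \<Rightarrow> nat)
                    \<Rightarrow> (nat \<Rightarrow> 'a \<Rightarrow> bool) \<Rightarrow> nat \<Rightarrow> 'a set set" where
  "info M F0 LR LS C n = sigma_sets (space M)
     (F0 \<union>
      {(\<lambda>w. if j \<le> Rcnt C n w then Some (LR j w) else None) -` A \<inter> space M | j A. 1 \<le> j} \<union>
      {(\<lambda>w. if j \<le> Scnt C n w then Some (LS j w) else None) -` A \<inter> space M | j A. 1 \<le> j})"

definition reading_policy :: "'a measure \<Rightarrow> 'a set set \<Rightarrow> (nat \<Rightarrow> 'a \<Rightarrow> nat) \<Rightarrow> (nat \<Rightarrow> 'a \<Rightarrow> nat)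
                    \<Rightarrow> (nat \<Rightarrow> 'a \<Rightarrow> bool) \<Rightarrow> bool" where
  "reading_policy M F0 LR LS C \<longleftrightarrow>
     (\<forall>n\<ge>1. {w \<in> space M. C n w} \<in> info M F0 LR LS C (n - 1))"

definition alternating_policy :: "'a measure \<Rightarrow> 'a set set \<Rightarrow> (nat \<Rightarrow> 'a \<Rightarrow> nat) \<Rightarrow> (nat \<Rightarrow> 'a \<Rightarrow> nat)
                    \<Rightarrow> (nat \<Rightarrow> 'a \<Rightarrow> bool) \<Rightarrow> bool" where
  "alternating_policy M F0 LR LS C \<longleftrightarrow>
     reading_policy M F0 LR LS C \<and>
     (\<forall>n\<ge>1. {w \<in> space M. C n w} \<in> F0) \<and>
     (\<forall>n. \<forall>w\<in>space M. Rcnt C (2 * n) w = n)"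

definition greedy_policy :: "'a measure \<Rightarrow> 'a set set \<Rightarrow> (nat \<Rightarrow> real) \<Rightarrow> (nat \<Rightarrow> real)
                    \<Rightarrow> (nat \<Rightarrow> 'a \<Rightarrow> nat) \<Rightarrow> (nat \<Rightarrow> 'a \<Rightarrow> nat) \<Rightarrow> (nat \<Rightarrow> 'a \<Rightarrow> bool) \<Rightarrow> bool" where
  "greedy_policy M F0 r s LR LS C \<longleftrightarrow>
     reading_policy M F0 LR LS C \<and>
     (\<forall>n\<ge>1. \<forall>w\<in>space M.
        (Gam r LS (Scnt C n w) w > Gam s LR (Rcnt C n w) w \<longrightarrow> C (n + 1) w) \<and>
        (Gam r LS (Scnt C n w) w < Gam s LR (Rcnt C n w) w \<longrightarrow> \<not> C (n + 1) w))"

definition normal0 :: "real \<Rightarrow> real measure" where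
  "normal0 v = (if v = 0 then return borel 0 else density lborel (normal_density 0 (sqrt v)))"

definition mixF :: "real \<Rightarrow> real measure" where
  "mixF v = bind (distr (normal0 v) borel abs) normal0"

end

theory Submission
  imports Defs "HOL-Real_Asymp.Real_Asymp"
begin

text \<open>
  Splitting \<open>1{x = y}\<close> into \<open>s x + r y - mu\<close> and a degenerate kernel, the number of matches after reading
  \<open>a\<close> records from R and \<open>n - a\<close> from S becomes
  \<open>(n - a) D\<^sub>R(a) + a D\<^sub>S(n - a) + mu a (n - a)\<close> plus a kernel sum, where \<open>D\<^sub>R\<close> and \<open>D\<^sub>S\<close> are centred
  random walks. The kernels are orthogonal, so changing \<open>a\<close> by little more than \<open>\<surd>n\<close> moves the
  kernel sum by \<open>o(n\<^bsup>5/4\<^esup>)\<close>. Greediness forces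
  \<open>a - n/2 \<approx> (D\<^sub>S - D\<^sub>R) / (2 mu)\<close>, which is of order \<open>\<surd>n\<close>, and the leading term of the difference of the two
  policies is \<open>n/2\<close> times the increments of the walks over a window of that length next to \<open>n/2\<close>.

  Hoeffding's inequality makes the modulus of continuity of the walks nearly \<open>\<surd>L\<close> over every window of
  length \<open>L\<close>. Hence the displacement may be replaced by its value computed from the
  first \<open>n/2 - l\<close> labels of each sequence, where \<open>l\<close> is slightly larger than \<open>\<surd>n\<close>. This proxy is independent
  of the increments, which conditionally on it are sums of independent terms: the characteristic function
  is asymptotically a Laplace transform of the absolute displacement, whose limit follows from
  the central limit theorem. Levy's continuity theorem concludes.
\<close>

section \<open>Characteristic functions of scale mixtures\<close>

text \<open>Fubini for the joint law of \<open>U\<close> and \<open>V\<close>, which is a product.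
  It stands in for conditioning on \<open>V\<close>: a value v is frozen, \<open>G v\<close> is the
  remaining expectation over \<open>U\<close>, and v is then set to \<open>V w\<close>.\<close>

lemma (in prob_space) expectation_indep_pair:
  fixes F :: "'u \<times> 'u \<Rightarrow> 'b::{banach, second_countable_topology}"
  assumes ind: "indep_var N1 U N2 V"
    and F[measurable]: "F \<in> borel_measurable (N1 \<Otimes>\<^sub>M N2)"
    and bdd: "\<And>x. norm (F x) \<le> B"
    and G: "\<And>v. v \<in> space N2 \<Longrightarrow> (\<integral>w. F (U w, v) \<partial>M) = G v"
  shows "(\<integral>w. F (U w, V w) \<partial>M) = (\<integral>w. G (V w) \<partial>M)"
proof -
  have U[measurable]: "U \<in> measurable M N1" and V[measurable]: "V \<in> measurable M N2"
    using ind by (auto dest: indep_var_rv1 indep_var_rv2)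
  interpret PU: prob_space "distr M N1 U" by (rule prob_space_distr) simp
  interpret PV: prob_space "distr M N2 V" by (rule prob_space_distr) simp
  interpret P: pair_prob_space "distr M N1 U" "distr M N2 V" ..
  have eq: "distr M (N1 \<Otimes>\<^sub>M N2) (\<lambda>w. (U w, V w)) = distr M N1 U \<Otimes>\<^sub>M distr M N2 V"
    using ind by (simp add: indep_var_distribution_eq)
  have "(\<integral>w. F (U w, V w) \<partial>M) = integral\<^sup>L (distr M (N1 \<Otimes>\<^sub>M N2) (\<lambda>w. (U w, V w))) F"
    by (simp add: integral_distr)
  also have "\<dots> = integral\<^sup>L (distr M N1 U \<Otimes>\<^sub>M distr M N2 V) (\<lambda>(x, y). F (x, y))"
    by (simp add: eq)
  also have "\<dots> = (\<integral>y. (\<integral>x. F (x, y) \<partial>distr M N1 U) \<partial>distr M N2 V)"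
    by (rule P.integral_snd[symmetric]) (auto intro!: P.P.integrable_const_bound[where B=B] bdd)
  also have "\<dots> = (\<integral>w. (\<integral>x. F (x, V w) \<partial>distr M N1 U) \<partial>M)"
    by (rule integral_distr) (auto intro!: PU.borel_measurable_lebesgue_integral)
  also have "\<dots> = (\<integral>w. G (V w) \<partial>M)"
  proof (rule Bochner_Integration.integral_cong[OF refl])
    fix w assume "w \<in> space M"
    then have v: "V w \<in> space N2" using measurable_space[OF V] by simp
    have "(\<integral>x. F (x, V w) \<partial>distr M N1 U) = (\<integral>w'. F (U w', V w) \<partial>M)"
      by (rule integral_distr) (use v in auto)
    then show "(\<integral>x. F (x, V w) \<partial>distr M N1 U) = G (V w)" using G[OF v] by simp
  qed
  finally show ?thesis .
qed

lemma distr_scaled_std_normal: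
  assumes "c \<noteq> 0"
  shows "distr std_normal_distribution borel (\<lambda>z. c * z) = density lborel (normal_density 0 \<bar>c\<bar>)"
proof -
  interpret prob_space std_normal_distribution by (rule prob_space_normal_density) simp
  have "distributed std_normal_distribution lborel (\<lambda>x. x) std_normal_density"
    by (auto simp: distributed_def distr_id2)
  from normal_density_affine[OF this _ assms, of 0]
  have "distributed std_normal_distribution lborel (\<lambda>x. c * x) (normal_density 0 \<bar>c\<bar>)" by simp
  then have "density lborel (normal_density 0 \<bar>c\<bar>) = distr std_normal_distribution lborel (\<lambda>x. c * x)"
    by (rule distributed_distr_eq_density[symmetric])
  also have "\<dots> = distr std_normal_distribution borel (\<lambda>x. c * x)"
    by (rule distr_cong) auto
  finally show ?thesis by simp
qed

text \<open>Scaling one standard normal variable absorbs the point mass at v = 0 and makes the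
  dependence on v visibly measurable.\<close>

lemma normal0_eq_distr: "normal0 v = distr std_normal_distribution borel (\<lambda>z. sqrt \<bar>v\<bar> * z)"
proof (cases "v = 0")
  case True
  interpret prob_space std_normal_distribution by (rule prob_space_normal_density) simp
  show ?thesis using True by (simp add: normal0_def)
next
  case False
  \<comment> \<open>The real \<open>sqrt\<close> is odd and the density sees only its square, so a
    negative v acts like its absolute value.\<close>
  have "normal_density 0 (sqrt v) = normal_density 0 (sqrt \<bar>v\<bar>)"
    by (simp add: normal_density_def fun_eq_iff power2_eq_square)
  then show ?thesis using False distr_scaled_std_normal[of "sqrt \<bar>v\<bar>"]
    by (simp add: normal0_def)
qed

lemma measurable_normal0[measurable]: "normal0 \<in> measurable borel (subprob_algebra borel)"
proof -
  interpret prob_space std_normal_distribution by (rule prob_space_normal_density) simp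
  have "std_normal_distribution \<in> space (subprob_algebra borel)"
    by (auto simp: space_subprob_algebra intro!: prob_space_imp_subprob_space prob_space_axioms)
  then have "(\<lambda>v. distr std_normal_distribution borel (\<lambda>z. sqrt \<bar>v\<bar> * z)) \<in> measurable borel (subprob_algebra borel)"
    by (intro measurable_distr2[where M=borel]) auto
  then show ?thesis by (simp add: normal0_eq_distr[abs_def])
qed

text \<open>The mixture is the law of sqrt |W| times z, where W = sqrt |v| x and x, z are
  independent standard normals. The monadic bind thus becomes a pushforward of a product
  measure.\<close>

lemma mixF_eq_distr:
  "mixF v = distr (std_normal_distribution \<Otimes>\<^sub>M std_normal_distribution) borel
     (\<lambda>(x, z). sqrt (sqrt \<bar>v\<bar> * \<bar>x\<bar>) * z)"
proof (rule measure_eqI)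
  interpret N: prob_space std_normal_distribution by (rule prob_space_normal_density) simp
  have abs_eq: "distr (normal0 v) borel abs = distr std_normal_distribution borel (\<lambda>x. sqrt \<bar>v\<bar> * \<bar>x\<bar>)"
    unfolding normal0_eq_distr by (subst distr_distr) (auto simp: o_def abs_mult)
  have sb: "sets (mixF v) = sets borel"
    unfolding mixF_def by (rule sets_bind[where N=borel]) (auto simp: normal0_eq_distr)
  then show "sets (mixF v) = sets (distr (std_normal_distribution \<Otimes>\<^sub>M std_normal_distribution) borel
     (\<lambda>(x, z). sqrt (sqrt \<bar>v\<bar> * \<bar>x\<bar>) * z))" by simp
  fix A assume "A \<in> sets (mixF v)"
  then have [measurable]: "A \<in> sets borel" using sb by simp
  have "(\<lambda>(x::real, z::real). sqrt (sqrt \<bar>v\<bar> * \<bar>x\<bar>) * z) \<in> borel_measurable (borel \<Otimes>\<^sub>M borel)"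
    by measurable
  from measurable_sets[OF this, of A]
  have pre: "(\<lambda>(x, z). sqrt (sqrt \<bar>v\<bar> * \<bar>x\<bar>) * z) -` A \<in> sets (borel \<Otimes>\<^sub>M borel)"
    by (simp add: space_pair_measure)
  have "emeasure (mixF v) A = (\<integral>\<^sup>+ w. emeasure (normal0 w) A \<partial>distr (normal0 v) borel abs)"
    unfolding mixF_def by (rule emeasure_bind[where N=borel]) auto
  also have "\<dots> = (\<integral>\<^sup>+ x. emeasure (normal0 (sqrt \<bar>v\<bar> * \<bar>x\<bar>)) A \<partial>std_normal_distribution)"
    unfolding abs_eq
    by (subst nn_integral_distr) (auto intro!: measurable_emeasure_subprob_algebra[THEN measurable_compose[OF measurable_normal0]])
  also have "\<dots> = (\<integral>\<^sup>+ x. emeasure std_normal_distribution (Pair x -` ((\<lambda>(x, z). sqrt (sqrt \<bar>v\<bar> * \<bar>x\<bar>) * z) -` A)) \<partial>std_normal_distribution)"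
    unfolding normal0_eq_distr
    by (intro nn_integral_cong, subst emeasure_distr) (auto simp: abs_mult intro!: arg_cong2[where f=emeasure])
  also have "\<dots> = emeasure (std_normal_distribution \<Otimes>\<^sub>M std_normal_distribution)
      ((\<lambda>(x, z). sqrt (sqrt \<bar>v\<bar> * \<bar>x\<bar>) * z) -` A \<inter> space (std_normal_distribution \<Otimes>\<^sub>M std_normal_distribution))"
    using pre by (subst N.emeasure_pair_measure_alt) (auto simp: space_pair_measure)
  also have "\<dots> = emeasure (distr (std_normal_distribution \<Otimes>\<^sub>M std_normal_distribution) borel
     (\<lambda>(x, z). sqrt (sqrt \<bar>v\<bar> * \<bar>x\<bar>) * z)) A"
    by (rule emeasure_distr[symmetric]) auto
  finally show "emeasure (mixF v) A = \<dots>" .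
qed

lemma real_distribution_mixF: "real_distribution (mixF v)"
proof -
  interpret N: prob_space std_normal_distribution by (rule prob_space_normal_density) simp
  interpret NN: pair_prob_space std_normal_distribution std_normal_distribution ..
  show ?thesis unfolding mixF_eq_distr by (rule NN.P.real_distribution_distr) auto
qed

text \<open>Integrating out z first leaves the Laplace transform of |W| at t^2/2, the form in which
  the limit arises later.\<close>

lemma char_mixF:
  "char (mixF v) t = (LINT x|std_normal_distribution. complex_of_real (exp (- (t\<^sup>2) * (sqrt \<bar>v\<bar> * \<bar>x\<bar>) / 2)))"
proof -
  interpret N: prob_space std_normal_distribution by (rule prob_space_normal_density) simp
  interpret NN: pair_prob_space std_normal_distribution std_normal_distribution ..
  have "char (mixF v) t = (CLINT p|std_normal_distribution \<Otimes>\<^sub>M std_normal_distribution.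
      (\<lambda>(x, z). iexp (t * (sqrt (sqrt \<bar>v\<bar> * \<bar>x\<bar>) * z))) p)"
    unfolding mixF_eq_distr char_def by (subst integral_distr) (auto simp: case_prod_unfold)
  also have "\<dots> = (CLINT x|std_normal_distribution. CLINT z|std_normal_distribution. iexp (t * (sqrt (sqrt \<bar>v\<bar> * \<bar>x\<bar>) * z)))"
    by (rule NN.integral_fst[symmetric]) (auto intro!: NN.P.integrable_const_bound[where B=1] simp: case_prod_unfold)
  also have "\<dots> = (CLINT x|std_normal_distribution. char std_normal_distribution (t * sqrt (sqrt \<bar>v\<bar> * \<bar>x\<bar>)))"
    by (simp add: char_def mult_ac)
  also have "\<dots> = (LINT x|std_normal_distribution. complex_of_real (exp (- (t\<^sup>2) * (sqrt \<bar>v\<bar> * \<bar>x\<bar>) / 2)))"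
    by (simp add: char_std_normal_distribution power_mult_distrib)
  finally show ?thesis .
qed

text \<open>The Taylor remainder of third order gives the first error because |X| is at most 1.
  Replacing 1 - y by exp (-y) with y = t^2 Var X / 2 costs y^2/2, and y is at most t^2/2. The error
  is explicit so that it can be summed over many factors.\<close>

lemma (in prob_space) char_bounded_quadratic:
  fixes X :: "'a \<Rightarrow> real"
  assumes [measurable]: "random_variable borel X" and b: "\<And>w. w \<in> space M \<Longrightarrow> \<bar>X w\<bar> \<le> 1"
    and E0: "expectation X = 0"
  shows "cmod (char (distr M borel X) t - exp (- (t\<^sup>2 * variance X / 2))) \<le> \<bar>t\<bar>^3 / 6 + t^4 / 8"
proof -
  have i1: "integrable M X" by (rule integrable_const_bound[where B=1]) (auto intro!: AE_I2 b)
  have sq: "(X w)\<^sup>2 \<le> 1" if "w \<in> space M" for w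
    using b[OF that] by (simp add: abs_square_le_1)
  have i2: "integrable M (\<lambda>w. (X w)\<^sup>2)" by (rule integrable_const_bound[where B=1]) (auto intro!: AE_I2 sq)
  have v: "variance X \<le> 1"
    using integral_mono[OF i2, of "\<lambda>_. 1"] sq E0 by (simp add: prob_space)
  have v0: "0 \<le> variance X" by (intro integral_nonneg_AE) auto
  have "cmod (char (distr M borel X) t - (1 - t\<^sup>2 * variance X / 2)) \<le>
    (t\<^sup>2 / 6) * expectation (\<lambda>x. min (6 * (X x)^2) (\<bar>t\<bar> * \<bar>X x\<bar>^3))"
    by (rule char_approx3'[OF assms(1) i1 i2 E0 refl refl])
  also have "expectation (\<lambda>x. min (6 * (X x)^2) (\<bar>t\<bar> * \<bar>X x\<bar>^3)) \<le> expectation (\<lambda>x. \<bar>t\<bar>)"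
  proof (rule integral_mono)
    show "integrable M (\<lambda>x. min (6 * (X x)^2) (\<bar>t\<bar> * \<bar>X x\<bar>^3))"
      by (rule Bochner_Integration.integrable_bound[OF integrable_mult_right[OF i2, of 6]]) auto
    fix w assume "w \<in> space M"
    then have "\<bar>X w\<bar>^3 \<le> 1" using b by (simp add: power_le_one)
    then have "\<bar>t\<bar> * \<bar>X w\<bar>^3 \<le> \<bar>t\<bar>" using mult_left_mono[of "\<bar>X w\<bar>^3" 1 "\<bar>t\<bar>"] by simp
    then show "min (6 * (X w)^2) (\<bar>t\<bar> * \<bar>X w\<bar>^3) \<le> \<bar>t\<bar>" by simp
  qed simp
  also have "expectation (\<lambda>x. \<bar>t\<bar>) = \<bar>t\<bar>" by (simp add: prob_space)
  finally have 1: "cmod (char (distr M borel X) t - (1 - t\<^sup>2 * variance X / 2)) \<le> \<bar>t\<bar>^3 / 6"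
    by (simp add: mult_left_mono power2_eq_square power3_eq_cube)
  define y where "y = t\<^sup>2 * variance X / 2"
  have y0: "0 \<le> y" and y1: "y \<le> t\<^sup>2 / 2"
    using v0 v mult_left_mono[OF v, of "t\<^sup>2"] by (auto simp: y_def)
  have "\<bar>exp (- y) - (1 - y)\<bar> \<le> y\<^sup>2 / 2"
  proof -
    have "exp (-y) \<le> 1 - y + y\<^sup>2 / 2"
    proof -
      have "exp y \<ge> 1 + y + y\<^sup>2/2" using exp_lower_Taylor_quadratic[OF y0] by simp
      \<comment> \<open>The product equals 1 + y^4/4, so the quadratic lower bound for exp y turns
        into a quadratic upper bound for exp (-y).\<close>
      moreover have "(1 - y + y\<^sup>2/2) * (1 + y + y\<^sup>2/2) \<ge> 1"
        using y0 by (simp add: power2_eq_square algebra_simps)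
      moreover have "1 - y + y\<^sup>2/2 \<ge> 0"
        using zero_le_power2[of "y - 1"] by (simp add: power2_eq_square algebra_simps)
      ultimately have "(1 - y + y\<^sup>2/2) * exp y \<ge> 1"
        by (meson mult_left_mono order_trans)
      then show ?thesis by (simp add: exp_minus field_simps)
    qed
    moreover have "exp (-y) \<ge> 1 - y" using exp_ge_add_one_self[of "-y"] by simp
    ultimately show ?thesis by (simp add: abs_if)
  qed
  also have "\<dots> \<le> (t\<^sup>2/2)\<^sup>2 / 2" using power_mono[OF y1 y0, of 2] by simp
  also have "\<dots> = t^4/8" by (simp add: power_divide)
  finally have "\<bar>exp (- y) - (1 - y)\<bar> \<le> t^4/8" .
  then have "\<bar>(1 - y) - exp (- y)\<bar> \<le> t^4/8" by (simp only: abs_minus_commute)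
  then have "cmod (complex_of_real ((1 - y) - exp (- y))) \<le> t^4 / 8"
    by (simp only: norm_of_real)
  then have 2: "cmod ((1 - t\<^sup>2 * variance X / 2) - complex_of_real (exp (- y))) \<le> t^4 / 8"
    by (simp add: y_def)
  show ?thesis using norm_triangle_le[OF add_mono[OF 1 2]] by (simp add: y_def)
qed

section \<open>The degenerate part of the match count\<close>

lemma Ncnt_eq_sum: "Ncnt L m i w = (\<Sum>j=1..m. of_bool (L j w = i))"
  by (simp add: Ncnt_def sum_of_bool_eq Int_def)

text \<open>A label value contributes every pair of positions carrying it in the two streams.
  Counting pairs instead of values exposes the indicator that is decomposed below.\<close>

lemma matches_eq_sum:
  "matches LR LS C n w = (\<Sum>a=1..Rcnt C n w. \<Sum>b=1..Scnt C n w. of_bool (LR a w = LS b w))"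
proof -
  let ?R = "Rcnt C n w" and ?S = "Scnt C n w"
  have I: "{i. 0 < Ncnt LR ?R i w} = (\<lambda>a. LR a w) ` {1..?R}"
    by (auto simp: Ncnt_def card_gt_0_iff)
  have "matches LR LS C n w = (\<Sum>i\<in>(\<lambda>a. LR a w) ` {1..?R}. \<Sum>a=1..?R. of_bool (LR a w = i) * Ncnt LS ?S i w)"
    unfolding matches_def I by (simp add: Ncnt_eq_sum[of LR] sum_distrib_right)
  also have "\<dots> = (\<Sum>a=1..?R. \<Sum>i\<in>(\<lambda>a. LR a w) ` {1..?R}. of_bool (LR a w = i) * Ncnt LS ?S i w)"
    by (rule sum.swap)
  also have "\<dots> = (\<Sum>a=1..?R. Ncnt LS ?S (LR a w) w)"
  proof (rule sum.cong[OF refl])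
    fix a assume "a \<in> {1..?R}"
    then have m: "LR a w \<in> (\<lambda>a. LR a w) ` {1..?R}" by blast
    have "(\<Sum>i\<in>(\<lambda>a. LR a w) ` {1..?R}. of_bool (LR a w = i) * Ncnt LS ?S i w)
        = (\<Sum>i\<in>(\<lambda>a. LR a w) ` {1..?R}. if LR a w = i then Ncnt LS ?S i w else 0)"
      by (rule sum.cong) auto
    also have "\<dots> = Ncnt LS ?S (LR a w) w" using m by (simp add: sum.delta')
    finally show "(\<Sum>i\<in>(\<lambda>a. LR a w) ` {1..?R}. of_bool (LR a w = i) * Ncnt LS ?S i w)
        = Ncnt LS ?S (LR a w) w" .
  qed
  finally show ?thesis by (simp add: Ncnt_eq_sum eq_commute[of "LS _ w"])
qed

section \<open>Two label streams: laws, centred scores and the degenerate kernel\<close>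

locale label_streams = prob_space M for M :: "'a measure" +
  fixes r s :: "nat \<Rightarrow> real" and LR LS :: "nat \<Rightarrow> 'a \<Rightarrow> nat"
  assumes r_nonneg: "\<forall>i. 0 \<le> r i" and r_sum: "r sums 1"
    and s_nonneg: "\<forall>i. 0 \<le> s i" and s_sum: "s sums 1"
    and LR_dist: "\<forall>n\<ge>1. \<forall>i. measure M {w \<in> space M. LR n w = i} = r i"
    and LS_dist: "\<forall>n\<ge>1. \<forall>i. measure M {w \<in> space M. LS n w = i} = s i"
    and indep: "indep_vars (\<lambda>_. count_space UNIV)
                  (\<lambda>(b, n). if b then LR n else LS n) (UNIV \<times> {1..})"
begin

definition mu :: real where "mu = (\<Sum>i. r i * s i)"

text \<open>Both streams form one family indexed by stream (\<open>True\<close> for R) and position,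
  so that independence of two sets of labels reduces to disjointness of their index sets.\<close>

definition label :: "bool \<times> nat \<Rightarrow> 'a \<Rightarrow> nat" where
  "label p = (if fst p then LR (snd p) else LS (snd p))"

definition law :: "bool \<Rightarrow> nat \<Rightarrow> real" where "law b = (if b then r else s)"

text \<open>A label x of stream b meets a fresh label of the other stream with probability
  \<open>law (\<not> b) x\<close>; hence the negation. These are the scores of the two streams,
  centred.\<close>

definition cscore :: "bool \<Rightarrow> nat \<Rightarrow> real" where "cscore b x = law (\<not> b) x - mu"

definition dev :: "bool \<times> nat \<Rightarrow> 'a \<Rightarrow> real" where "dev p w = cscore (fst p) (label p w)"

definition drift :: "bool \<Rightarrow> nat \<Rightarrow> 'a \<Rightarrow> real" where "drift b m w = (\<Sum>j=1..m. dev (b, j) w)"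

text \<open>The remainder in the Hoeffding decomposition of the indicator of a match: averaging over
  either label with the other one fixed gives 0.\<close>

definition kern :: "nat \<Rightarrow> nat \<Rightarrow> real" where
  "kern x y = of_bool (x = y) - s x - r y + mu"

definition Hsum :: "nat \<Rightarrow> nat \<Rightarrow> 'a \<Rightarrow> real" where
  "Hsum a b w = (\<Sum>i=1..a. \<Sum>j=1..b. kern (LR i w) (LS j w))"

lemma law_nonneg: "0 \<le> law b x" using r_nonneg s_nonneg by (simp add: law_def)

lemma law_sums: "law b sums 1" using r_sum s_sum by (simp add: law_def)

lemma law_le_1: "law b x \<le> 1"
  using sum_le_suminf[OF sums_summable[OF law_sums[of b]], of "{x}"] law_nonneg[of b] law_sums[of b]
  by (simp add: sums_iff)

lemma summable_law_mult: "summable (\<lambda>i. law b i * law c i)"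
  by (rule summable_comparison_test'[OF sums_summable[OF law_sums[of b]], of 0])
     (simp add: law_nonneg law_le_1 mult_left_le)

lemma mu_eq_suminf: "mu = (\<Sum>i. law b i * law (\<not> b) i)"
  by (cases b) (simp_all add: mu_def law_def mult.commute)

lemma mu_bounds: "0 \<le> mu" "mu \<le> 1"
proof -
  have m: "mu = (\<Sum>i. law True i * law False i)" by (simp add: mu_eq_suminf[of True])
  show "0 \<le> mu" unfolding m by (rule suminf_nonneg[OF summable_law_mult]) (simp add: law_nonneg)
  have "mu \<le> (\<Sum>i. law True i)" unfolding m
    by (rule suminf_le[OF _ summable_law_mult sums_summable[OF law_sums]])
       (simp add: law_nonneg law_le_1 mult_left_le)
  then show "mu \<le> 1" using law_sums[of True] by (simp add: sums_iff)
qed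

lemma abs_cscore_le_1: "\<bar>cscore b x\<bar> \<le> 1"
  using law_nonneg[of "\<not> b" x] law_le_1[of "\<not> b" x] mu_bounds by (auto simp: cscore_def abs_if)

lemma abs_kern_le_2: "\<bar>kern x y\<bar> \<le> 2"
  using law_nonneg[of True y] law_le_1[of True y] law_nonneg[of False x] law_le_1[of False x] mu_bounds
  by (auto simp: kern_def law_def of_bool_def abs_if)

lemma indep_labels: "indep_vars (\<lambda>_. count_space UNIV) label (UNIV \<times> {1..})"
  using indep by (simp add: label_def[abs_def] case_prod_unfold)

lemma measurable_label: "1 \<le> snd p \<Longrightarrow> label p \<in> measurable M (count_space UNIV)"
  using indep_labels unfolding indep_vars_def by (cases p) auto

lemma measurable_LR[measurable]: "1 \<le> n \<Longrightarrow> LR n \<in> measurable M (count_space UNIV)"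
  and measurable_LS[measurable]: "1 \<le> n \<Longrightarrow> LS n \<in> measurable M (count_space UNIV)"
  using measurable_label[of "(True, n)"] measurable_label[of "(False, n)"] by (auto simp: label_def)

lemma prob_label: "1 \<le> snd p \<Longrightarrow> prob {w \<in> space M. label p w = i} = law (fst p) i"
  using LR_dist LS_dist by (simp add: label_def law_def)

text \<open>The variable is expanded over the events that the label equals i. Boundedness of g makes
  the integrals of the absolute values summable, which allows the series and the integral to be
  exchanged.\<close>

lemma label_expectation_sums:
  fixes g :: "nat \<Rightarrow> real"
  assumes p: "1 \<le> snd p" and g: "\<And>i. \<bar>g i\<bar> \<le> B"
  shows "(\<lambda>i. law (fst p) i * g i) sums expectation (\<lambda>w. g (label p w))"
proof -
  note [measurable] = measurable_label[OF p]
  let ?f = "\<lambda>i w. g i * indicator {w \<in> space M. label p w = i} w"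
  have B: "0 \<le> B" using g[of 0] by (meson abs_ge_zero order_trans)
  have ev: "{w \<in> space M. label p w = i} \<in> sets M" for i by measurable
  have int: "integrable M (?f i)" for i
    using ev by (intro integrable_mult_right integrable_real_indicator) (auto simp: emeasure_eq_measure)
  have val: "expectation (?f i) = law (fst p) i * g i" for i
    using ev by (simp add: prob_label[OF p] Int_absorb1 sets.sets_into_space mult.commute)
  have nrm: "expectation (\<lambda>w. norm (?f i w)) = law (fst p) i * \<bar>g i\<bar>" for i
    using ev by (simp add: abs_mult prob_label[OF p] mult.commute)
  have single: "(\<lambda>i. ?f i w) sums g (label p w)" if "w \<in> space M" for w
  proof -
    have "(\<lambda>i. ?f i w) = (\<lambda>i. if i = label p w then g i else 0)" using that by (auto simp: indicator_def fun_eq_iff)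
    then show ?thesis using sums_single[of "label p w" g] by simp
  qed
  have "(\<lambda>i. expectation (?f i)) sums (\<integral>w. (\<Sum>i. ?f i w) \<partial>M)"
  proof (rule sums_integral)
    show "AE w in M. summable (\<lambda>i. norm (?f i w))"
    proof (rule AE_I2)
      fix w assume w: "w \<in> space M"
      have "(\<lambda>i. norm (?f i w)) = (\<lambda>i. if i = label p w then \<bar>g i\<bar> else 0)"
        using w by (auto simp: indicator_def fun_eq_iff)
      then show "summable (\<lambda>i. norm (?f i w))"
        using sums_summable[OF sums_single[of "label p w" "\<lambda>i. \<bar>g i\<bar>"]] by simp
    qed
    show "summable (\<lambda>i. \<integral>w. norm (?f i w) \<partial>M)"
      unfolding nrm
      by (rule summable_comparison_test'[OF summable_mult2[OF sums_summable[OF law_sums[of "fst p"]], of B], of 0])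
         (simp add: law_nonneg abs_mult mult_left_mono g)
  qed (rule int)
  also have "(\<integral>w. (\<Sum>i. ?f i w) \<partial>M) = expectation (\<lambda>w. g (label p w))"
    by (rule Bochner_Integration.integral_cong[OF refl]) (simp add: sums_unique[OF single, symmetric])
  finally show ?thesis unfolding val .
qed

lemma expectation_label:
  fixes g :: "nat \<Rightarrow> real"
  assumes "1 \<le> snd p" and "\<And>i. \<bar>g i\<bar> \<le> B"
  shows "expectation (\<lambda>w. g (label p w)) = (\<Sum>i. law (fst p) i * g i)"
  using label_expectation_sums[OF assms] by (simp add: sums_iff)

lemma expectation_law_label:
  assumes "1 \<le> snd p"
  shows "expectation (\<lambda>w. law (\<not> fst p) (label p w)) = mu"
  using expectation_label[OF assms, of "law (\<not> fst p)" 1] law_nonneg law_le_1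
  by (simp add: mu_eq_suminf[of "fst p"])

lemma integrable_label:
  fixes g :: "nat \<Rightarrow> real"
  assumes p: "1 \<le> snd p" and "\<And>i. \<bar>g i\<bar> \<le> B"
  shows "integrable M (\<lambda>w. g (label p w))"
  using measurable_label[OF p] assms(2) by (intro integrable_const_bound[where B=B]) auto

lemma expectation_cscore:
  assumes "1 \<le> snd p"
  shows "expectation (\<lambda>w. cscore (fst p) (label p w)) = 0"
  unfolding cscore_def
  using expectation_law_label[OF assms] integrable_label[OF assms, of "law (\<not> fst p)" 1] law_nonneg law_le_1
  by (simp add: prob_space)

lemma expectation_eq_label:
  assumes p: "1 \<le> snd p"
  shows "expectation (\<lambda>w. of_bool (label p w = y)) = law (fst p) y"
proof -
  have "expectation (\<lambda>w. of_bool (label p w = y)) = (\<Sum>i. law (fst p) i * of_bool (i = y))"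
    by (rule expectation_label[OF p, of "\<lambda>i. of_bool (i = y)" 1]) auto
  also have "(\<lambda>i. law (fst p) i * of_bool (i = y)) = (\<lambda>i. if i = y then law (fst p) i else 0)" by auto
  finally show ?thesis using sums_unique[OF sums_single[of y "law (fst p)"]] by simp
qed

lemma expectation_kern_R:
  assumes i: "1 \<le> i"
  shows "expectation (\<lambda>w. kern (LR i w) y) = 0"
proof -
  let ?p = "(True, i)"
  have "integrable M (\<lambda>w. of_bool (label ?p w = y) :: real)" "integrable M (\<lambda>w. s (label ?p w))"
    using i law_nonneg[of False] law_le_1[of False]
    by (auto intro!: integrable_label[where B=1 and g="\<lambda>x. of_bool (x = y)"] integrable_label[where B=1 and g=s] simp: law_def)
  then have "expectation (\<lambda>w. kern (label ?p w) y) = r y - mu - r y + mu"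
    using expectation_eq_label[of ?p y] expectation_law_label[of ?p] i
    by (simp add: kern_def law_def prob_space)
  then show ?thesis by (simp add: label_def)
qed

lemma expectation_kern_S:
  assumes j: "1 \<le> j"
  shows "expectation (\<lambda>w. kern x (LS j w)) = 0"
proof -
  let ?p = "(False, j)"
  have "integrable M (\<lambda>w. of_bool (label ?p w = x) :: real)" "integrable M (\<lambda>w. r (label ?p w))"
    using j law_nonneg[of True] law_le_1[of True]
    by (auto intro!: integrable_label[where B=1 and g="\<lambda>y. of_bool (y = x)"] integrable_label[where B=1 and g=r] simp: law_def)
  then have "expectation (\<lambda>w. kern x (label ?p w)) = s x - s x - mu + mu"
    using expectation_eq_label[of ?p x] expectation_law_label[of ?p] j
    by (simp add: kern_def law_def prob_space eq_commute[of x])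
  then show ?thesis by (simp add: label_def)
qed

lemma measurable_kern[measurable]:
  assumes [measurable]: "f \<in> measurable N (count_space UNIV)" "g \<in> measurable N (count_space UNIV)"
  shows "(\<lambda>x. kern (f x) (g x)) \<in> borel_measurable N"
proof -
  have "(\<lambda>x. (f x, g x)) \<in> measurable N (count_space UNIV)"
    using measurable_Pair[OF assms] by (simp add: pair_measure_countable)
  from measurable_compose[OF this, of "\<lambda>(x, y). kern x y" borel] show ?thesis by simp
qed

lemma indep_label_blocks:
  assumes "J \<inter> K = {}" "J \<subseteq> UNIV \<times> {1..}" "K \<subseteq> UNIV \<times> {1..}"
  shows "indep_var (PiM J (\<lambda>_. count_space UNIV)) (\<lambda>w. \<lambda>p\<in>J. label p w)
                   (PiM K (\<lambda>_. count_space UNIV)) (\<lambda>w. \<lambda>p\<in>K. label p w)"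
  by (rule indep_var_restrict[OF indep_labels assms])

text \<open>Distinct index pairs differ in some coordinate. The label at that coordinate of the
  first pair occurs in one factor only and is independent of the other labels; averaging over it
  first gives 0 by degeneracy of the kernel.\<close>

lemma kern_orthogonal:
  assumes ij: "1 \<le> i" "1 \<le> j" "1 \<le> i'" "1 \<le> j'" "(i, j) \<noteq> (i', j')"
  shows "expectation (\<lambda>w. kern (LR i w) (LS j w) * kern (LR i' w) (LS j' w)) = 0"
proof -
  have bd: "norm (kern x y * kern x' y') \<le> 2 * 2" for x y x' y'
    unfolding norm_mult using abs_kern_le_2 by (intro mult_mono) auto
  show ?thesis
  proof (cases "i = i'")
    case False
    let ?J = "{(True, i)}" and ?K = "{(True, i'), (False, j), (False, j')}"
    let ?F = "\<lambda>(u, v). kern (u (True, i)) (v (False, j)) * kern (v (True, i')) (v (False, j'))"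
    have "(\<integral>w. ?F (\<lambda>p\<in>?J. label p w, \<lambda>p\<in>?K. label p w) \<partial>M) = (\<integral>w. 0 \<partial>M)"
    proof (rule expectation_indep_pair[OF indep_label_blocks, where B="2*2"])
      show "?F \<in> borel_measurable (PiM ?J (\<lambda>_. count_space UNIV) \<Otimes>\<^sub>M PiM ?K (\<lambda>_. count_space UNIV))"
        by measurable
    qed (use ij False bd expectation_kern_R in \<open>auto simp: label_def\<close>)
    then show ?thesis by (simp add: label_def)
  next
    case True
    then have "j \<noteq> j'" using ij by auto
    let ?J = "{(False, j)}" and ?K = "{(True, i), (True, i'), (False, j')}"
    let ?F = "\<lambda>(u, v). kern (v (True, i)) (u (False, j)) * kern (v (True, i')) (v (False, j'))"
    have "(\<integral>w. ?F (\<lambda>p\<in>?J. label p w, \<lambda>p\<in>?K. label p w) \<partial>M) = (\<integral>w. 0 \<partial>M)"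
    proof (rule expectation_indep_pair[OF indep_label_blocks, where B="2*2"])
      show "?F \<in> borel_measurable (PiM ?J (\<lambda>_. count_space UNIV) \<Otimes>\<^sub>M PiM ?K (\<lambda>_. count_space UNIV))"
        by measurable
    qed (use ij \<open>j \<noteq> j'\<close> bd expectation_kern_S in \<open>auto simp: label_def\<close>)
    then show ?thesis by (simp add: label_def)
  qed
qed

text \<open>Orthogonality leaves only the diagonal, where each term is at most 4. The coefficients
  let a difference of two kernel sums be treated as one signed sum.\<close>

lemma kern_sum_second_moment:
  fixes c :: "nat \<times> nat \<Rightarrow> real"
  assumes A: "finite A" "A \<subseteq> {1..} \<times> {1..}" and c: "\<And>p. \<bar>c p\<bar> \<le> 1"
  shows "expectation (\<lambda>w. (\<Sum>(i,j)\<in>A. c (i,j) * kern (LR i w) (LS j w))\<^sup>2) \<le> 4 * card A"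
proof -
  let ?k = "\<lambda>p w. kern (LR (fst p) w) (LS (snd p) w)"
  have bd: "\<bar>kern x y * kern x' y'\<bar> \<le> 2 * 2" for x y x' y'
    unfolding abs_mult using abs_kern_le_2 by (intro mult_mono) auto
  have int: "integrable M (\<lambda>w. c p * c q * (?k p w * ?k q w))" if "p \<in> A" "q \<in> A" for p q
  proof -
    have [measurable]: "LR (fst p) \<in> measurable M (count_space UNIV)" "LS (snd p) \<in> measurable M (count_space UNIV)"
       "LR (fst q) \<in> measurable M (count_space UNIV)" "LS (snd q) \<in> measurable M (count_space UNIV)"
      using that A by auto
    show ?thesis
      by (intro integrable_mult_right integrable_const_bound[where B="2*2"]) (use bd in auto)
  qed
  have "expectation (\<lambda>w. (\<Sum>(i,j)\<in>A. c (i,j) * kern (LR i w) (LS j w))\<^sup>2)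
      = expectation (\<lambda>w. \<Sum>p\<in>A. \<Sum>q\<in>A. c p * c q * (?k p w * ?k q w))"
    by (simp add: power2_eq_square sum_product case_prod_unfold mult_ac)
  also have "\<dots> = (\<Sum>p\<in>A. \<Sum>q\<in>A. expectation (\<lambda>w. c p * c q * (?k p w * ?k q w)))"
    using int by (simp add: Bochner_Integration.integral_sum)
  also have "\<dots> = (\<Sum>p\<in>A. \<Sum>q\<in>A. if q = p then c p * c p * expectation (\<lambda>w. ?k p w * ?k p w) else 0)"
  proof (intro sum.cong refl)
    fix p q assume pq: "p \<in> A" "q \<in> A"
    show "expectation (\<lambda>w. c p * c q * (?k p w * ?k q w))
      = (if q = p then c p * c p * expectation (\<lambda>w. ?k p w * ?k p w) else 0)"
    proof (cases "q = p")
      case False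
      then have "(fst p, snd p) \<noteq> (fst q, snd q)" by (metis prod.collapse)
      moreover have "1 \<le> fst p" "1 \<le> snd p" "1 \<le> fst q" "1 \<le> snd q" using pq A by auto
      ultimately have "expectation (\<lambda>w. ?k p w * ?k q w) = 0" by (intro kern_orthogonal)
      then show ?thesis using False by simp
    qed simp
  qed
  also have "\<dots> = (\<Sum>p\<in>A. c p * c p * expectation (\<lambda>w. ?k p w * ?k p w))"
    using A by (simp add: sum.delta)
  also have "\<dots> \<le> (\<Sum>p\<in>A. 4)"
  proof (rule sum_mono)
    fix p assume p: "p \<in> A"
    have [measurable]: "LR (fst p) \<in> measurable M (count_space UNIV)" "LS (snd p) \<in> measurable M (count_space UNIV)"
      using p A by auto
    have sq: "?k p w * ?k p w \<le> 4" for w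
      using bd[of "LR (fst p) w" "LS (snd p) w" "LR (fst p) w" "LS (snd p) w"] by simp
    have "integrable M (\<lambda>w. ?k p w * ?k p w)"
      by (intro integrable_const_bound[where B=4] AE_I2) (use sq in auto)
    then have "expectation (\<lambda>w. ?k p w * ?k p w) \<le> expectation (\<lambda>w. 4)"
      using sq by (intro integral_mono) auto
    then have e: "expectation (\<lambda>w. ?k p w * ?k p w) \<le> 4" by (simp add: prob_space)
    have e0: "0 \<le> expectation (\<lambda>w. ?k p w * ?k p w)" by (intro integral_nonneg_AE) auto
    have "c p * c p \<le> 1" using c[of p] by (metis abs_square_le_1 power2_eq_square)
    then have "c p * c p * expectation (\<lambda>w. ?k p w * ?k p w) \<le> 1 * 4"
      using e e0 by (intro mult_mono) auto
    then show "c p * c p * expectation (\<lambda>w. ?k p w * ?k p w) \<le> 4" by simp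
  qed
  finally show ?thesis by simp
qed

end

section \<open>Concentration of the centred walks and of the kernel sums\<close>

lemma sum_Icc_split:
  fixes f :: "nat \<Rightarrow> 'b::comm_monoid_add"
  assumes "x \<le> y"
  shows "(\<Sum>j=1..y. f j) = (\<Sum>j=1..x. f j) + (\<Sum>j\<in>{x<..y}. f j)"
proof -
  have "{1..y} = {1..x} \<union> {x<..y}" "{1..x} \<inter> {x<..y} = {}" using assms by auto
  then show ?thesis by (simp only: sum.union_disjoint finite_atLeastAtMost finite_greaterThanAtMost)
qed

context label_streams
begin

lemma measurable_dev: "1 \<le> snd p \<Longrightarrow> dev p \<in> borel_measurable M"
  unfolding dev_def[abs_def] by (rule measurable_compose[OF measurable_label]) auto

lemma measurable_drift[measurable]: "drift b m \<in> borel_measurable M"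
  unfolding drift_def[abs_def] by (intro borel_measurable_sum measurable_dev) auto

lemma abs_dev_le_1: "\<bar>dev p w\<bar> \<le> 1"
  by (simp add: dev_def abs_cscore_le_1)

lemma expectation_dev: "1 \<le> snd p \<Longrightarrow> expectation (dev p) = 0"
  unfolding dev_def[abs_def] by (rule expectation_cscore)

lemma indep_dev: "indep_vars (\<lambda>_. borel) dev (UNIV \<times> {1..})"
  unfolding dev_def[abs_def] by (rule indep_vars_compose2[OF indep_labels]) auto

lemma drift_diff: "x \<le> y \<Longrightarrow> drift b y w - drift b x w = (\<Sum>p\<in>{b} \<times> {x<..y}. dev p w)"
proof -
  assume "x \<le> y"
  then have "drift b y w = drift b x w + (\<Sum>j\<in>{x<..y}. dev (b, j) w)"
    unfolding drift_def by (rule sum_Icc_split)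
  moreover have "(\<Sum>j\<in>{x<..y}. dev (b, j) w) = (\<Sum>p\<in>{b} \<times> {x<..y}. dev p w)"
    by (rule sum.reindex_bij_witness[of _ snd "Pair b"]) auto
  ultimately show ?thesis by simp
qed

text \<open>Each increment lies in an interval of length 1, so the squared lengths add up to y - x.
  Measuring the deviation in units of sqrt (y - x) makes the bound the same for all windows.\<close>

lemma drift_Hoeffding:
  assumes "x < y" "0 \<le> e"
  shows "prob {w\<in>space M. \<bar>drift b y w - drift b x w\<bar> \<ge> e * sqrt (real (y - x))} \<le> 2 * exp (- 2 * e\<^sup>2)"
proof -
  let ?I = "{b} \<times> {x<..y}"
  have I: "p \<in> ?I \<Longrightarrow> 1 \<le> snd p" for p by auto
  have z: "(\<Sum>p\<in>?I. expectation (dev p)) = 0"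
    using expectation_dev I by (simp add: sum.neutral)
  interpret Hoeffding_ineq M ?I dev "\<lambda>_. - mu" "\<lambda>_. 1 - mu" "\<Sum>p\<in>?I. expectation (dev p)"
  proof unfold_locales
    show "indep_vars (\<lambda>_. borel) dev ?I" by (rule indep_vars_subset[OF indep_dev]) auto
    show "AE w in M. dev i w \<in> {- mu..1 - mu}" for i
      using law_nonneg law_le_1 by (auto simp: dev_def cscore_def)
  qed auto
  have c: "(\<Sum>i\<in>?I. (1 - mu - - mu)\<^sup>2) = real (y - x)" using assms by simp
  have "prob {w\<in>space M. \<bar>(\<Sum>p\<in>?I. dev p w) - 0\<bar> \<ge> e * sqrt (real (y - x))}
     \<le> 2 * exp (-2 * (e * sqrt (real (y - x)))\<^sup>2 / real (y - x))"
    using Hoeffding_ineq_abs_ge[of "e * sqrt (real (y - x))"] assms unfolding z c by simp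
  also have "-2 * (e * sqrt (real (y - x)))\<^sup>2 / real (y - x) = - 2 * e\<^sup>2"
    using assms by (simp add: power_mult_distrib field_simps)
  finally show ?thesis using assms by (simp add: drift_diff)
qed

definition smooth_drift :: "nat \<Rightarrow> real \<Rightarrow> 'a \<Rightarrow> bool" where
  "smooth_drift n e w \<longleftrightarrow> (\<forall>b x y. x \<le> y \<longrightarrow> y \<le> n \<longrightarrow> \<bar>drift b y w - drift b x w\<bar> \<le> e * sqrt (real (y - x)))"

text \<open>A union bound over the two streams and all pairs x < y up to n, at most 2 (n + 1)^2
  cases. A small power of n for e makes the exponential beat this polynomial.\<close>

lemma prob_not_smooth_drift:
  assumes e: "0 \<le> e"
  shows "{w\<in>space M. \<not> smooth_drift n e w} \<in> sets M"
    and "prob {w\<in>space M. \<not> smooth_drift n e w} \<le> 4 * (real n + 1)\<^sup>2 * exp (- 2 * e\<^sup>2)"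
proof -
  let ?B = "\<lambda>(b, x, y). {w\<in>space M. \<bar>drift b y w - drift b x w\<bar> > e * sqrt (real (y - x))}"
  let ?C = "\<lambda>(b, x, y). {w\<in>space M. \<bar>drift b y w - drift b x w\<bar> \<ge> e * sqrt (real (y - x))}"
  let ?T = "{(b, x, y). x < y \<and> y \<le> n} :: (bool \<times> nat \<times> nat) set"
  have T: "?T \<subseteq> UNIV \<times> {..n} \<times> {..n}" by auto
  have fT: "finite ?T" by (rule finite_subset[OF T]) simp
  have "card ?T \<le> card (UNIV \<times> {..n} \<times> {..n} :: (bool \<times> nat \<times> nat) set)"
    by (rule card_mono[OF _ T]) simp
  then have "card ?T \<le> 2 * (n + 1)\<^sup>2"
    by (simp add: card_cartesian_product power2_eq_square)
  from of_nat_mono[OF this, where 'a=real]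
  have cT: "real (card ?T) \<le> 2 * (real n + 1)\<^sup>2" by (simp add: add.commute)
  have eq: "{w\<in>space M. \<not> smooth_drift n e w} = (\<Union>q\<in>?T. ?B q)" (is "?L = ?R")
  proof (intro equalityI subsetI)
    fix w assume w: "w \<in> ?L"
    then obtain b x y where xy: "x \<le> y" "y \<le> n" "\<not> \<bar>drift b y w - drift b x w\<bar> \<le> e * sqrt (real (y - x))"
      by (auto simp: smooth_drift_def)
    then have "x \<noteq> y" by auto
    then show "w \<in> ?R" using w xy by (intro UN_I[of "(b, x, y)"]) auto
  next
    fix w assume "w \<in> ?R"
    then obtain b x y where xy: "x < y" "y \<le> n" "e * sqrt (real (y - x)) < \<bar>drift b y w - drift b x w\<bar>" "w \<in> space M"
      by auto
    then have "\<not> smooth_drift n e w" unfolding smooth_drift_def by (meson less_imp_le not_le)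
    then show "w \<in> ?L" using xy by simp
  qed
  show "?L \<in> sets M" unfolding eq by (rule sets.finite_UN[OF fT]) auto
  have "prob ?L \<le> (\<Sum>q\<in>?T. prob (?B q))"
    unfolding eq by (rule finite_measure_subadditive_finite[OF fT]) auto
  also have "\<dots> \<le> (\<Sum>q\<in>?T. 2 * exp (- 2 * e\<^sup>2))"
  proof (rule sum_mono)
    fix q assume "q \<in> ?T"
    then obtain b x y where q: "q = (b, x, y)" "x < y" by auto
    have "prob (?B q) \<le> prob (?C q)" unfolding q by (intro finite_measure_mono) auto
    also have "\<dots> \<le> 2 * exp (- 2 * e\<^sup>2)" unfolding q using drift_Hoeffding[OF q(2) e] by simp
    finally show "prob (?B q) \<le> 2 * exp (- 2 * e\<^sup>2)" .
  qed
  also have "\<dots> = real (card ?T) * (2 * exp (- 2 * e\<^sup>2))" by simp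
  also have "\<dots> \<le> 2 * (real n + 1)\<^sup>2 * (2 * exp (- 2 * e\<^sup>2))"
    by (rule mult_right_mono[OF cT]) simp
  finally show "prob ?L \<le> 4 * (real n + 1)\<^sup>2 * exp (- 2 * e\<^sup>2)" by simp
qed

section \<open>Kernel sums over nearby rectangles\<close>

lemma measurable_Hsum[measurable]: "Hsum a b \<in> borel_measurable M"
  unfolding Hsum_def[abs_def] by (intro borel_measurable_sum measurable_kern) auto

text \<open>The rectangles with sides (a, n - a) and (a', n - a') share the one with sides (a, n -
  a'). The difference is a signed sum over the two leftover pieces \<open>?A1\<close> and
  \<open>?A2\<close>, which together have at most n (a' - a) cells.\<close>

lemma Hsum_diff_second_moment_aux:
  assumes "a \<le> a'" "a' \<le> n"
  shows "expectation (\<lambda>w. (Hsum a (n - a) w - Hsum a' (n - a') w)\<^sup>2) \<le> 4 * (real n * real (a' - a))"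
proof -
  let ?A1 = "{1..a} \<times> {n-a'<..n-a}" and ?A2 = "{a<..a'} \<times> {1..n-a'}"
  let ?c = "\<lambda>p. if p \<in> ?A1 then 1 else - 1 :: real"
  have dis: "?A1 \<inter> ?A2 = {}" by auto
  have "Hsum a (n - a) w - Hsum a' (n - a') w = (\<Sum>(i,j)\<in>?A1 \<union> ?A2. ?c (i,j) * kern (LR i w) (LS j w))" for w
  proof -
    let ?k = "\<lambda>i j. kern (LR i w) (LS j w)"
    have n: "n - a' \<le> n - a" using assms by simp
    have 1: "Hsum a (n - a) w = Hsum a (n - a') w + (\<Sum>i=1..a. \<Sum>j\<in>{n-a'<..n-a}. ?k i j)"
      and 2: "Hsum a' (n - a') w = Hsum a (n - a') w + (\<Sum>i\<in>{a<..a'}. \<Sum>j=1..n-a'. ?k i j)"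
      unfolding Hsum_def sum_Icc_split[OF n] sum_Icc_split[OF assms(1)] by (simp_all add: sum.distrib)
    have 3: "(\<Sum>(i,j)\<in>?A1 \<union> ?A2. ?c (i,j) * ?k i j) = (\<Sum>(i,j)\<in>?A1. ?c (i,j) * ?k i j) + (\<Sum>(i,j)\<in>?A2. ?c (i,j) * ?k i j)"
      by (rule sum.union_disjoint) (use dis in auto)
    have 4: "(\<Sum>(i,j)\<in>?A1. ?c (i,j) * ?k i j) = (\<Sum>(i,j)\<in>?A1. ?k i j)"
      by (rule sum.cong) auto
    have 5: "(\<Sum>(i,j)\<in>?A2. ?c (i,j) * ?k i j) = (\<Sum>(i,j)\<in>?A2. - ?k i j)"
      by (rule sum.cong) auto
    show ?thesis unfolding 3 4 5 unfolding 1 2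
      by (simp add: sum.cartesian_product[symmetric] sum_negf)
  qed
  then have "expectation (\<lambda>w. (Hsum a (n - a) w - Hsum a' (n - a') w)\<^sup>2)
     = expectation (\<lambda>w. (\<Sum>(i,j)\<in>?A1 \<union> ?A2. ?c (i,j) * kern (LR i w) (LS j w))\<^sup>2)" by simp
  also have "\<dots> \<le> 4 * card (?A1 \<union> ?A2)"
    by (rule kern_sum_second_moment) auto
  also have "card (?A1 \<union> ?A2) = a * (a' - a) + (a' - a) * (n - a')"
    using assms by (subst card_Un_disjoint[OF _ _ dis]) (auto simp: card_cartesian_product)
  also have "real (4 * (a * (a' - a) + (a' - a) * (n - a'))) \<le> real (4 * (n * (a' - a)))"
  proof -
    have "a * (a' - a) + (a' - a) * (n - a') = (a + (n - a')) * (a' - a)" by (simp add: algebra_simps)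
    also have "\<dots> \<le> n * (a' - a)" using assms by (intro mult_right_mono) auto
    finally show ?thesis by (simp only: of_nat_le_iff mult_le_mono2)
  qed
  finally show ?thesis by simp
qed

lemma Hsum_diff_second_moment:
  assumes "a \<le> n" "a' \<le> n" "\<bar>int a - int a'\<bar> \<le> int l"
  shows "expectation (\<lambda>w. (Hsum a (n - a) w - Hsum a' (n - a') w)\<^sup>2) \<le> 4 * (real n * real l)"
proof (cases "a \<le> a'")
  case True
  then have "real n * real (a' - a) \<le> real n * real l" using assms by (intro mult_left_mono) auto
  then show ?thesis using Hsum_diff_second_moment_aux[OF True assms(2)] by simp
next
  case False
  then have l: "real n * real (a - a') \<le> real n * real l" using assms by (intro mult_left_mono) auto
  have "expectation (\<lambda>w. (Hsum a (n - a) w - Hsum a' (n - a') w)\<^sup>2) \<le> 4 * (real n * real (a - a'))"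
    using Hsum_diff_second_moment_aux[of a' a n] False assms(1) by (simp add: power2_commute)
  then show ?thesis using l by linarith
qed

lemma abs_Hsum_le: "\<bar>Hsum a b w\<bar> \<le> 2 * real a * real b"
proof -
  have "\<bar>Hsum a b w\<bar> \<le> (\<Sum>i=1..a. \<Sum>j=1..b. 2)"
    unfolding Hsum_def
    by (intro order_trans[OF sum_abs] sum_mono) (rule abs_kern_le_2)
  then show ?thesis by simp
qed

definition smooth_Hsum :: "nat \<Rightarrow> nat \<Rightarrow> nat \<Rightarrow> real \<Rightarrow> 'a \<Rightarrow> bool" where
  "smooth_Hsum n m l t w \<longleftrightarrow>
     (\<forall>a\<le>n. \<bar>int a - int m\<bar> \<le> int l \<longrightarrow> \<bar>Hsum a (n - a) w - Hsum m (n - m) w\<bar> \<le> t)"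

text \<open>Chebyshev's inequality for each split point and a union bound over the at most 2 l + 1
  split points in the window.\<close>

lemma prob_not_smooth_Hsum:
  assumes t: "0 < t" and m: "m \<le> n"
  shows "{w\<in>space M. \<not> smooth_Hsum n m l t w} \<in> sets M"
    and "prob {w\<in>space M. \<not> smooth_Hsum n m l t w} \<le> (2 * real l + 1) * (4 * (real n * real l) / t\<^sup>2)"
proof -
  let ?D = "\<lambda>a w. Hsum a (n - a) w - Hsum m (n - m) w"
  let ?B = "\<lambda>a. {w\<in>space M. t < \<bar>?D a w\<bar>}"
  let ?T = "{a. a \<le> n \<and> \<bar>int a - int m\<bar> \<le> int l}"
  have T: "?T \<subseteq> {m-l..m+l}" by auto
  have fT: "finite ?T" by (rule finite_subset[OF T]) simp
  have "card ?T \<le> card {m-l..m+l}" by (rule card_mono[OF _ T]) simp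
  then have cT: "real (card ?T) \<le> 2 * real l + 1" by simp
  have eq: "{w\<in>space M. \<not> smooth_Hsum n m l t w} = (\<Union>a\<in>?T. ?B a)"
    by (auto simp: smooth_Hsum_def not_le)
  show "{w\<in>space M. \<not> smooth_Hsum n m l t w} \<in> sets M"
    unfolding eq by (rule sets.finite_UN[OF fT]) measurable
  have "prob {w\<in>space M. \<not> smooth_Hsum n m l t w} \<le> (\<Sum>a\<in>?T. prob (?B a))"
    unfolding eq by (rule finite_measure_subadditive_finite[OF fT]) auto
  also have "\<dots> \<le> (\<Sum>a\<in>?T. 4 * (real n * real l) / t\<^sup>2)"
  proof (rule sum_mono)
    fix a assume a: "a \<in> ?T"
    have int: "integrable M (\<lambda>w. (?D a w)\<^sup>2)"
    proof (rule integrable_const_bound)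
      have "\<bar>?D a w\<bar> \<le> 2 * real a * real (n - a) + 2 * real m * real (n - m)" for w
        using abs_Hsum_le[of a "n-a" w] abs_Hsum_le[of m "n-m" w] by linarith
      then have "\<bar>?D a w\<bar>\<^sup>2 \<le> (2 * real a * real (n - a) + 2 * real m * real (n - m))\<^sup>2" for w
        by (intro power_mono) auto
      then show "AE w in M. norm ((?D a w)\<^sup>2) \<le> (2 * real a * real (n - a) + 2 * real m * real (n - m))\<^sup>2"
        by auto
    qed measurable
    have "t\<^sup>2 \<le> (?D a w)\<^sup>2" if "t < \<bar>?D a w\<bar>" for w
      using power_mono[of t "\<bar>?D a w\<bar>" 2] that t by simp
    then have "prob (?B a) \<le> prob {w\<in>space M. t\<^sup>2 \<le> (?D a w)\<^sup>2}"
      by (intro finite_measure_mono) auto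
    also have "\<dots> \<le> expectation (\<lambda>w. (?D a w)\<^sup>2) / t\<^sup>2"
      using t by (intro integral_Markov_inequality_measure[OF int, of "{}"]) auto
    also have "\<dots> \<le> 4 * (real n * real l) / t\<^sup>2"
      using a m Hsum_diff_second_moment[of a n m l] by (intro divide_right_mono) auto
    finally show "prob (?B a) \<le> 4 * (real n * real l) / t\<^sup>2" .
  qed
  also have "\<dots> = real (card ?T) * (4 * (real n * real l) / t\<^sup>2)" by simp
  also have "\<dots> \<le> (2 * real l + 1) * (4 * (real n * real l) / t\<^sup>2)"
    by (rule mult_right_mono[OF cT]) simp
  finally show "prob {w\<in>space M. \<not> smooth_Hsum n m l t w} \<le> (2 * real l + 1) * (4 * (real n * real l) / t\<^sup>2)" .
qed

text \<open>The Hoeffding decomposition of each indicator, summed over the rectangle. The identity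
  holds for each outcome, so the split point a may be random and depend on the labels.\<close>

lemma matches_decomposition:
  assumes "Rcnt C n w = a" "a \<le> n"
  shows "real (matches LR LS C n w) =
    real (n - a) * drift True a w + real a * drift False (n - a) w + mu * real a * real (n - a) + Hsum a (n - a) w"
proof -
  let ?b = "n - a"
  have "real (matches LR LS C n w) = (\<Sum>i=1..a. \<Sum>j=1..?b. of_bool (LR i w = LS j w))"
    using assms by (simp add: matches_eq_sum Scnt_def)
  also have "\<dots> = (\<Sum>i=1..a. \<Sum>j=1..?b. kern (LR i w) (LS j w) + dev (True, i) w + dev (False, j) w + mu)"
    by (intro sum.cong refl) (simp add: kern_def dev_def cscore_def law_def label_def)
  also have "\<dots> = Hsum a ?b w + real ?b * drift True a w + real a * drift False ?b w + mu * real a * real ?b"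
    by (simp add: sum.distrib Hsum_def drift_def sum_distrib_left mult_ac)
  finally show ?thesis by simp
qed

lemma Gam_eq_drift:
  "Gam s LR m w = drift True m w + mu * real m" "Gam r LS m w = drift False m w + mu * real m"
  by (simp_all add: Gam_def drift_def dev_def cscore_def law_def label_def sum_subtractf)

end

section \<open>Pathwise expansion of the match count\<close>

text \<open>The deterministic counterpart of \<open>smooth_drift\<close> for a single path; with it
  the expansion below is a statement about fixed functions.\<close>

definition root_mod :: "nat \<Rightarrow> real \<Rightarrow> (nat \<Rightarrow> real) \<Rightarrow> bool" where
  "root_mod n e D \<longleftrightarrow> (\<forall>x y. x \<le> y \<longrightarrow> y \<le> n \<longrightarrow> \<bar>D y - D x\<bar> \<le> e * sqrt (real (y - x)))"

text \<open>The change of the two walks when the even split (m, m) is replaced by (m + d, m - d).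
  Multiplied by n/2 it is the leading term of the change in matches.\<close>

definition swap_inc :: "(nat \<Rightarrow> real) \<Rightarrow> (nat \<Rightarrow> real) \<Rightarrow> nat \<Rightarrow> int \<Rightarrow> real" where
  "swap_inc DR DS m d = (DR (nat (int m + d)) - DR m) + (DS (nat (int m - d)) - DS m)"

text \<open>Balance of DR + u (m + d) with DS + u (m - d) asks for d = (DS - DR) / (2 u). Clamping
  confines the shift to the window for every outcome, so the labels it exchanges stay in a fixed
  range.\<close>

definition clamp_shift :: "real \<Rightarrow> nat \<Rightarrow> real \<Rightarrow> int" where
  "clamp_shift u l x = max (- int l) (min (int l) \<lfloor>x / (2 * u)\<rfloor>)"

lemma root_modD:
  assumes D: "root_mod n e D" and xy: "x \<le> n" "y \<le> n" "\<bar>real x - real y\<bar> \<le> c" and e: "0 \<le> e"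
  shows "\<bar>D x - D y\<bar> \<le> e * sqrt c"
proof (cases "x \<le> y")
  case True
  have "\<bar>D x - D y\<bar> \<le> e * sqrt (real (y - x))"
    using D True xy by (subst abs_minus_commute) (simp add: root_mod_def)
  also have "\<dots> \<le> e * sqrt c" using True xy e by (intro mult_left_mono real_sqrt_le_mono) auto
  finally show ?thesis .
next
  case False
  have "\<bar>D x - D y\<bar> \<le> e * sqrt (real (x - y))"
    using D False xy by (simp add: root_mod_def)
  also have "\<dots> \<le> e * sqrt c" using False xy e by (intro mult_left_mono real_sqrt_le_mono) auto
  finally show ?thesis .
qed

lemma swap_inc_diff:
  assumes DR: "root_mod n e DR" and DS: "root_mod n e DS" and e: "0 \<le> e"
    and m: "2 * m \<le> n" and l: "l \<le> m" and d: "\<bar>d\<bar> \<le> int l" "\<bar>d'\<bar> \<le> int l" "\<bar>real_of_int (d - d')\<bar> \<le> c"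
  shows "\<bar>swap_inc DR DS m d - swap_inc DR DS m d'\<bar> \<le> 2 * e * sqrt c"
proof -
  have r: "real (nat (int m + x)) = real m + real_of_int x" "real (nat (int m - x)) = real m - real_of_int x"
    if "\<bar>x\<bar> \<le> int l" for x using that l by (simp_all add: of_nat_nat)
  have b: "nat (int m + x) \<le> n" "nat (int m - x) \<le> n" if "\<bar>x\<bar> \<le> int l" for x using that l m by auto
  have "\<bar>DR (nat (int m + d)) - DR (nat (int m + d'))\<bar> \<le> e * sqrt c"
    by (rule root_modD[OF DR b(1) b(1) _ e]) (use d in \<open>auto simp: r\<close>)
  moreover have "\<bar>DS (nat (int m - d)) - DS (nat (int m - d'))\<bar> \<le> e * sqrt c"
    by (rule root_modD[OF DS b(2) b(2) _ e]) (use d in \<open>auto simp: r\<close>)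
  ultimately show ?thesis unfolding swap_inc_def abs_le_iff by (intro conjI; linarith)
qed

lemma abs_mult_le: "\<bar>x\<bar> \<le> a \<Longrightarrow> \<bar>y\<bar> \<le> b \<Longrightarrow> \<bar>x * y\<bar> \<le> a * b" for x y :: real
  unfolding abs_mult by (intro mult_mono) auto

text \<open>The product a (n - a) is flat at the middle, so the linear walk terms dominate. Every
  remaining term carries the displacement d with |d| \<le> l, the parity p or the change of H, and
  is bounded separately.\<close>

lemma match_profile_expansion:
  fixes H :: "nat \<Rightarrow> real"
  assumes DR: "root_mod n e DR" and DS: "root_mod n e DS" and e: "0 \<le> e" and z: "DR 0 = 0" "DS 0 = 0"
    and n: "n = 2 * m + p" "p \<le> 1" and l: "l \<le> m" and a: "\<bar>int a - int m\<bar> \<le> int l" "a \<le> n"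
    and H: "\<bar>H a - H m\<bar> \<le> t" and u: "0 \<le> u" "u \<le> 1"
  defines "Mv \<equiv> \<lambda>x. real (n - x) * DR x + real x * DS (n - x) + u * real x * real (n - x) + H x"
  shows "\<bar>Mv a - Mv m - real n / 2 * swap_inc DR DS m (int a - int m)\<bar>
    \<le> e * sqrt n + 2 * (real l * (e * sqrt n)) + real n * e + real l * (real l + 1) + t"
proof -
  define d where "d = real a - real m"
  define A where "A = DR a - DR m"
  define B where "B = DS (n - a) - DS (n - m)"
  define C1 where "C1 = DS (n - a) - DS (2 * m - a)"
  define C2 where "C2 = DS (n - m) - DS m"
  have am: "a \<le> 2 * m" and mn: "m \<le> n" using a l n by auto
  have sw: "swap_inc DR DS m (int a - int m) = A + (DS (2 * m - a) - DS m)"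
  proof -
    have "nat (int m - (int a - int m)) = 2 * m - a" by auto
    then show ?thesis by (simp add: swap_inc_def A_def)
  qed
  have rn: "real (n - a) = real n - real a" "real (n - m) = real n - real m" using a mn by auto
  have nn: "real n = 2 * real m + real p" using n by simp
  \<comment> \<open>The halves of p come from m = n/2 - p/2 and n - m = n/2 + p/2. \<open>C1\<close>
    and \<open>C2\<close> move an index of DS by p, to pass from splits of n to splits of 2 m. The
    quadratic part changes by d (p - d).\<close>
  have id: "Mv a - Mv m - real n / 2 * swap_inc DR DS m (int a - int m) =
    (real p / 2) * A - d * DR a + (- real p / 2) * B + d * DS (n - a) + real n / 2 * (C1 - C2) + u * (d * (real p - d)) + (H a - H m)"
    unfolding Mv_def sw rn A_def B_def C1_def C2_def d_def nn by (simp add: field_simps)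
  have d: "\<bar>d\<bar> \<le> real l" using a by (simp add: d_def)
  have p: "\<bar>real p / 2\<bar> \<le> 1 / 2" "\<bar>- real p / 2\<bar> \<le> 1 / 2" using n by auto
  have bA: "\<bar>A\<bar> \<le> e * sqrt n" unfolding A_def
    by (rule root_modD[OF DR a(2) mn _ e]) (use a mn in auto)
  have bB: "\<bar>B\<bar> \<le> e * sqrt n" unfolding B_def
    by (rule root_modD[OF DS _ _ _ e]) (use a mn in auto)
  have bR: "\<bar>DR a\<bar> \<le> e * sqrt n" using root_modD[OF DR a(2) _ _ e, of 0 n] a z by auto
  have bS: "\<bar>DS (n - a)\<bar> \<le> e * sqrt n" using root_modD[OF DS _ _ _ e, of "n - a" 0 n] a z by auto
  have b1: "\<bar>C1\<bar> \<le> e * sqrt 1" unfolding C1_def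
    by (rule root_modD[OF DS _ _ _ e]) (use a am n in auto)
  have b2: "\<bar>C2\<bar> \<le> e * sqrt 1" unfolding C2_def
    by (rule root_modD[OF DS _ _ _ e]) (use mn n in auto)
  have b12: "\<bar>C1 - C2\<bar> \<le> 2 * e" using b1 b2 by simp
  have pd: "\<bar>real p - d\<bar> \<le> real l + 1" using d n(2) by simp
  have t1: "\<bar>(real p / 2) * A\<bar> \<le> 1 / 2 * (e * sqrt n)" by (rule abs_mult_le[OF p(1) bA])
  have t2: "\<bar>d * DR a\<bar> \<le> real l * (e * sqrt n)" by (rule abs_mult_le[OF d bR])
  have t3: "\<bar>(- real p / 2) * B\<bar> \<le> 1 / 2 * (e * sqrt n)" by (rule abs_mult_le[OF p(2) bB])
  have t4: "\<bar>d * DS (n - a)\<bar> \<le> real l * (e * sqrt n)" by (rule abs_mult_le[OF d bS])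
  have t5: "\<bar>real n / 2 * (C1 - C2)\<bar> \<le> real n / 2 * (2 * e)" by (rule abs_mult_le[OF _ b12]) simp
  have t6: "\<bar>u * (d * (real p - d))\<bar> \<le> 1 * (real l * (real l + 1))"
    by (intro abs_mult_le d pd) (use u in auto)
  show ?thesis unfolding id using t1 t2 t3 t4 t5 t6 H unfolding abs_le_iff by (intro conjI; linarith)
qed

text \<open>Balance is used twice. A crude bound first puts a into the window; then the walks at a
  and n - a are compared with their values at m - l, which determines the displacement up to an
  error of order e sqrt l. One more use of the modulus shows that \<open>swap_inc\<close> barely
  feels this error.\<close>

lemma balanced_minus_middle:
  fixes H :: "nat \<Rightarrow> real"
  assumes DR: "root_mod n e DR" and DS: "root_mod n e DS" and e: "0 \<le> e" and z: "DR 0 = 0" "DS 0 = 0"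
    and n: "n = 2 * m + p" "p \<le> 1" and l: "1 \<le> l" "l \<le> m"
    and H: "\<And>x. \<bar>int x - int m\<bar> \<le> int l \<Longrightarrow> x \<le> n \<Longrightarrow> \<bar>H x - H m\<bar> \<le> t" and u: "0 < u" "u \<le> 1"
    and big: "(2 + 2 * (e * sqrt n)) / (2 * u) + 1 \<le> real l"
    and a: "a \<le> n" and bal: "\<bar>(DR a + u * real a) - (DS (n - a) + u * real (n - a))\<bar> \<le> 1"
    and a': "a' = m \<or> a' = m + 1" "a' \<le> n"
  defines "Mv \<equiv> \<lambda>x. real (n - x) * DR x + real x * DS (n - x) + u * real x * real (n - x) + H x"
  shows "\<bar>Mv a - Mv a' - real n / 2 * swap_inc DR DS m (clamp_shift u l (DS (m - l) - DR (m - l)))\<bar>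
    \<le> 2 * (e * sqrt n + 2 * (real l * (e * sqrt n)) + real n * e + real l * (real l + 1) + t)
      + real n * e + real n * e * sqrt (1 + (2 + 2 * (e * sqrt (2 * real l + 1))) / (2 * u))"
proof -
  define d where "d = int a - int m"
  define k where "k = m - l"
  define x where "x = DS k - DR k"
  define dl where "dl = clamp_shift u l x"
  define E where "E = e * sqrt n + 2 * (real l * (e * sqrt n)) + real n * e + real l * (real l + 1) + t"
  define rho where "rho = 1 + (2 + 2 * (e * sqrt (2 * real l + 1))) / (2 * u)"
  have kn: "k \<le> n" and kr: "real k = real m - real l" using n l by (auto simp: k_def)
  have b0: "\<bar>D y\<bar> \<le> e * sqrt n" if "root_mod n e D" "D 0 = 0" "y \<le> n" for D y
    using root_modD[OF that(1) that(3) _ _ e, of 0 n] that by auto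
  have rd: "2 * u * real_of_int d - (DS (n - a) - DR a) = (DR a + u * real a) - (DS (n - a) + u * real (n - a)) + u * real p"
    using a n by (simp add: d_def algebra_simps)
  have up: "0 \<le> u * real p" "u * real p \<le> 1" using u n mult_le_one[of u "real p"] by auto
  \<comment> \<open>Of the 2, one unit is the imbalance and one bounds the parity term
    \<open>u * real p\<close>.\<close>
  have dd: "\<bar>2 * u * real_of_int d - (DS (n - a) - DR a)\<bar> \<le> 2" unfolding rd using bal up unfolding abs_le_iff by (intro conjI; linarith)
  have "\<bar>DS (n - a) - DR a\<bar> \<le> 2 * (e * sqrt n)"
    using b0[OF DR z(1) a] b0[OF DS z(2), of "n - a"] by auto
  with dd have "\<bar>2 * u * real_of_int d\<bar> \<le> 2 + 2 * (e * sqrt n)" by linarith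
  then have "\<bar>real_of_int d\<bar> \<le> (2 + 2 * (e * sqrt n)) / (2 * u)"
    using u by (simp add: abs_mult field_simps)
  then have "\<bar>real_of_int d\<bar> \<le> real l" using big by linarith
  then have dl1: "\<bar>d\<bar> \<le> int l" by linarith
  have "\<bar>x\<bar> \<le> 2 * (e * sqrt n)"
    unfolding x_def using b0[OF DR z(1) kn] b0[OF DS z(2) kn] by auto
  then have "\<bar>x / (2 * u)\<bar> \<le> (2 + 2 * (e * sqrt n)) / (2 * u)"
    using u by (simp add: abs_mult divide_right_mono)
  then have "\<bar>x / (2 * u)\<bar> \<le> real l - 1" using big by linarith
  then have "- real l \<le> x / (2 * u)" "x / (2 * u) \<le> real l" unfolding abs_le_iff by linarith+
  then have "- int l \<le> \<lfloor>x / (2 * u)\<rfloor>" "\<lfloor>x / (2 * u)\<rfloor> \<le> int l" by linarith+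
  \<comment> \<open>On such paths the clamp is inactive, so \<open>dl\<close> is the plain floor.
    Its rounding error is the summand 1 in \<open>rho\<close>.\<close>
  then have dle: "dl = \<lfloor>x / (2 * u)\<rfloor>" by (simp add: dl_def clamp_shift_def)
  have dll: "\<bar>dl\<bar> \<le> int l" by (auto simp: dl_def clamp_shift_def)
  \<comment> \<open>Here n - a = m + p - d and k = m - l, which are at distance at most 2 l +
    1.\<close>
  have c1: "\<bar>DS (n - a) - DS k\<bar> \<le> e * sqrt (2 * real l + 1)"
    by (rule root_modD[OF DS _ kn _ e]) (use dl1 a n l in \<open>auto simp: kr d_def\<close>)
  have c2: "\<bar>DR a - DR k\<bar> \<le> e * sqrt (2 * real l + 1)"
    by (rule root_modD[OF DR a kn _ e]) (use dl1 in \<open>auto simp: kr d_def\<close>)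
  have "\<bar>2 * u * real_of_int d - x\<bar> \<le> 2 + 2 * (e * sqrt (2 * real l + 1))"
    unfolding x_def using dd c1 c2 unfolding abs_le_iff by (intro conjI; linarith)
  then have "\<bar>(2 * u * real_of_int d - x) / (2 * u)\<bar> \<le> (2 + 2 * (e * sqrt (2 * real l + 1))) / (2 * u)"
    using u by (simp add: abs_mult divide_right_mono)
  moreover have "(2 * u * real_of_int d - x) / (2 * u) = real_of_int d - x / (2 * u)"
    using u by (simp add: field_simps)
  ultimately have rho1: "\<bar>real_of_int (d - dl)\<bar> \<le> rho"
    unfolding dle rho_def of_int_diff by linarith
  have M1: "\<bar>Mv a - Mv m - real n / 2 * swap_inc DR DS m d\<bar> \<le> E"
    unfolding Mv_def E_def d_def
    by (rule match_profile_expansion[OF DR DS e z n l(2)]) (use dl1 a H u in \<open>auto simp: d_def\<close>)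
  have M2: "\<bar>Mv a' - Mv m - real n / 2 * swap_inc DR DS m (int a' - int m)\<bar> \<le> E"
    unfolding Mv_def E_def
    by (rule match_profile_expansion[OF DR DS e z n l(2)]) (use a' l H[of a'] u in auto)
  have s0: "swap_inc DR DS m 0 = 0" by (simp add: swap_inc_def)
  \<comment> \<open>The other split point is at most one step from the middle, so its exchange has
    size at most 2 e and costs n e in matches.\<close>
  have "\<bar>swap_inc DR DS m (int a' - int m) - swap_inc DR DS m 0\<bar> \<le> 2 * e * sqrt 1"
    by (rule swap_inc_diff[OF DR DS e _ l(2)]) (use n a' l in auto)
  then have "\<bar>swap_inc DR DS m (int a' - int m)\<bar> \<le> 2 * e" using s0 by simp
  then have I2: "\<bar>real n / 2 * swap_inc DR DS m (int a' - int m)\<bar> \<le> real n / 2 * (2 * e)"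
    by (intro abs_mult_le) auto
  have "\<bar>swap_inc DR DS m d - swap_inc DR DS m dl\<bar> \<le> 2 * e * sqrt rho"
    by (rule swap_inc_diff[OF DR DS e _ l(2) dl1 dll rho1]) (use n in auto)
  then have "\<bar>real n / 2 * (swap_inc DR DS m d - swap_inc DR DS m dl)\<bar> \<le> real n / 2 * (2 * e * sqrt rho)"
    by (intro abs_mult_le) auto
  then have I3: "\<bar>real n / 2 * swap_inc DR DS m d - real n / 2 * swap_inc DR DS m dl\<bar> \<le> real n * e * sqrt rho"
    by (simp add: algebra_simps)
  show ?thesis
    unfolding E_def[symmetric] rho_def[symmetric] k_def[symmetric] x_def[symmetric] dl_def[symmetric]
    using M1 M2 I2 I3 unfolding abs_le_iff by (intro conjI; linarith)
qed

section \<open>Reading policies\<close>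

lemma Rcnt_Suc: "Rcnt C (Suc n) w = Rcnt C n w + (if C (Suc n) w then 1 else 0)"
proof -
  have "{j \<in> {1..Suc n}. C j w} = {j \<in> {1..n}. C j w} \<union> (if C (Suc n) w then {Suc n} else {})"
    by (auto simp: le_Suc_eq)
  then show ?thesis by (auto simp: Rcnt_def)
qed

lemma Rcnt_le: "Rcnt C n w \<le> n"
proof (induction n)
  case 0 then show ?case by (simp add: Rcnt_def)
next
  case (Suc n) then show ?case by (simp add: Rcnt_Suc)
qed

lemma Scnt_Suc: "Scnt C (Suc n) w = Scnt C n w + (if C (Suc n) w then 0 else 1)"
  using Rcnt_le[of C n w] by (simp add: Scnt_def Rcnt_Suc)

lemma Gam_Suc: "Gam f L (Suc m) w = Gam f L m w + f (L (Suc m) w)"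
  by (simp add: Gam_def)

text \<open>A read adds a score in [0, 1] to the side that is not ahead, so an imbalance of at most
  1 persists.\<close>

lemma greedy_balanced:
  assumes g: "greedy_policy M F0 r s LR LS C" and w: "w \<in> space M"
    and r: "\<And>i. 0 \<le> r i" "\<And>i. r i \<le> 1" and s: "\<And>i. 0 \<le> s i" "\<And>i. s i \<le> 1"
  shows "\<bar>Gam s LR (Rcnt C n w) w - Gam r LS (Scnt C n w) w\<bar> \<le> 1"
proof (induction n)
  case 0 then show ?case by (simp add: Rcnt_def Scnt_def Gam_def)
next
  case (Suc n)
  let ?R = "Gam s LR (Rcnt C n w) w" and ?S = "Gam r LS (Scnt C n w) w"
  have st: "?S > ?R \<Longrightarrow> C (Suc n) w" "?S < ?R \<Longrightarrow> \<not> C (Suc n) w" if "n \<ge> 1"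
    using conjunct2[OF g[unfolded greedy_policy_def], rule_format, OF that w] by simp_all
  \<comment> \<open>The greedy rule starts at n = 1; the first read is made from a tie, where either
    choice preserves the bound.\<close>
  have z: "?R = 0" "?S = 0" if "n = 0" using that by (simp_all add: Rcnt_def Scnt_def Gam_def)
  have C: "C (Suc n) w \<longrightarrow> ?R \<le> ?S" "\<not> C (Suc n) w \<longrightarrow> ?S \<le> ?R"
  proof -
    have "(C (Suc n) w \<longrightarrow> ?R \<le> ?S) \<and> (\<not> C (Suc n) w \<longrightarrow> ?S \<le> ?R)"
    proof (cases "n \<ge> 1")
      case True
      then show ?thesis using st[OF True] by (meson not_le)
    next
      case False
      then have "n = 0" by simp
      from z[OF this] show ?thesis by simp
    qed
    then show "C (Suc n) w \<longrightarrow> ?R \<le> ?S" "\<not> C (Suc n) w \<longrightarrow> ?S \<le> ?R" by blast+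
  qed
  show ?case
  proof (cases "C (Suc n) w")
    case True
    then show ?thesis using C Suc s[of "LR (Suc (Rcnt C n w)) w"] by (simp add: Rcnt_Suc Scnt_Suc Gam_Suc)
  next
    case False
    then show ?thesis using C Suc r[of "LS (Suc (Scnt C n w)) w"] by (simp add: Rcnt_Suc Scnt_Suc Gam_Suc)
  qed
qed

text \<open>At even times the two counts agree; which stream is read at the following odd time is
  left open.\<close>

lemma alternating_middle:
  assumes "alternating_policy M F0 LR LS C" "w \<in> space M"
  shows "Rcnt C n w = n div 2 \<or> Rcnt C n w = n div 2 + 1"
proof -
  have e: "Rcnt C (2 * (n div 2)) w = n div 2" using assms by (simp add: alternating_policy_def)
  show ?thesis
  proof (cases "even n")
    case False
    then obtain k where k: "n = Suc (2 * k)" by (metis oddE Suc_eq_plus1)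
    then have "Rcnt C (2 * k) w = k" "n div 2 = k" using e by auto
    then show ?thesis using Rcnt_Suc[of C "2 * k" w] unfolding k by simp
  qed (use e in auto)
qed

text \<open>The information at time n is defined through the count at time n, so measurability is
  proved by induction: a measurable count makes the generators measurable events, hence also the
  next decision and the next count.\<close>

lemma reading_policy_measurable:
  fixes M :: "'a measure"
  assumes pol: "reading_policy M F0 LR LS C" and F0: "F0 \<subseteq> sets M"
    and LR[measurable]: "\<And>n. 1 \<le> n \<Longrightarrow> LR n \<in> measurable M (count_space UNIV)"
    and LS[measurable]: "\<And>n. 1 \<le> n \<Longrightarrow> LS n \<in> measurable M (count_space UNIV)"
  shows "Rcnt C n \<in> measurable M (count_space UNIV)"
proof (induction n)
  case 0
  have "Rcnt C 0 = (\<lambda>w. 0)" by (simp add: Rcnt_def fun_eq_iff)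
  then show ?case by simp
next
  case (Suc n)
  note [measurable] = Suc
  have S[measurable]: "Scnt C n \<in> measurable M (count_space UNIV)"
    unfolding Scnt_def[abs_def] by measurable
  have "info M F0 LR LS C n \<subseteq> sets M"
    unfolding info_def
  proof (rule sets.sigma_sets_subset, safe)
    fix j :: nat and A :: "nat option set" assume j: "1 \<le> j"
    note [measurable] = LR[OF j] LS[OF j]
    have "(\<lambda>w. if j \<le> Rcnt C n w then Some (LR j w) else None) \<in> measurable M (count_space UNIV)" by measurable
    then show "(\<lambda>w. if j \<le> Rcnt C n w then Some (LR j w) else None) -` A \<inter> space M \<in> sets M"
      by (rule measurable_sets) auto
    have "(\<lambda>w. if j \<le> Scnt C n w then Some (LS j w) else None) \<in> measurable M (count_space UNIV)" by measurable
    then show "(\<lambda>w. if j \<le> Scnt C n w then Some (LS j w) else None) -` A \<inter> space M \<in> sets M"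
      by (rule measurable_sets) auto
  qed (use F0 in auto)
  moreover have "{w \<in> space M. C (Suc n) w} \<in> info M F0 LR LS C n"
    using pol[unfolded reading_policy_def, rule_format, of "Suc n"] by simp
  ultimately have [measurable]: "Measurable.pred M (C (Suc n))" unfolding pred_def by blast
  show ?case unfolding Rcnt_Suc[abs_def] by measurable
qed

text \<open>For each fixed split point the count is a finite sum of measurable terms; the random
  split point takes countably many values.\<close>

lemma matches_measurable:
  fixes M :: "'a measure"
  assumes R[measurable]: "Rcnt C n \<in> measurable M (count_space UNIV)"
    and LR[measurable]: "\<And>n. 1 \<le> n \<Longrightarrow> LR n \<in> measurable M (count_space UNIV)"
    and LS[measurable]: "\<And>n. 1 \<le> n \<Longrightarrow> LS n \<in> measurable M (count_space UNIV)"
  shows "matches LR LS C n \<in> measurable M (count_space UNIV)"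
proof -
  have fixed: "(\<lambda>w. \<Sum>a=1..x. \<Sum>b=1..n - x. of_bool (LR a w = LS b w) :: nat) \<in> measurable M (count_space UNIV)" for x
  proof (intro measurable_sum_nat)
    fix a b assume "a \<in> {1..x}" "b \<in> {1..n - x}"
    then have [measurable]: "LR a \<in> measurable M (count_space UNIV)" "LS b \<in> measurable M (count_space UNIV)"
      using LR LS by auto
    show "(\<lambda>w. of_bool (LR a w = LS b w) :: nat) \<in> measurable M (count_space UNIV)" by measurable
  qed
  have "(\<lambda>w. (\<lambda>x. \<Sum>a=1..x. \<Sum>b=1..n - x. of_bool (LR a w = LS b w) :: nat) (Rcnt C n w)) \<in> measurable M (count_space UNIV)"
    by (rule measurable_compose_countable'[OF fixed R]) simp
  then show ?thesis by (simp add: matches_eq_sum[abs_def] Scnt_def)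
qed

section \<open>Increments at an independent displacement\<close>

text \<open>Off the exceptional event the integrands differ by at most e, on it by at most 2. The
  codomain is general so that both characteristic functions and real Laplace transforms are
  covered.\<close>

lemma (in prob_space) expectation_diff_le:
  fixes f g :: "'a \<Rightarrow> 'b::{banach, second_countable_topology}"
  assumes [measurable]: "f \<in> borel_measurable M" "g \<in> borel_measurable M" "B \<in> sets M"
    and bd: "\<And>w. w \<in> space M \<Longrightarrow> norm (f w) \<le> 1" "\<And>w. w \<in> space M \<Longrightarrow> norm (g w) \<le> 1"
    and close: "\<And>w. w \<in> space M \<Longrightarrow> w \<notin> B \<Longrightarrow> norm (f w - g w) \<le> e" and e: "0 \<le> e"
  shows "norm (expectation f - expectation g) \<le> e + 2 * prob B"
proof -
  have int: "integrable M f" "integrable M g"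
    using bd by (auto intro!: integrable_const_bound[where B=1])
  have intb: "integrable M (\<lambda>w. e + 2 * indicator B w)"
    by (intro Bochner_Integration.integrable_add integrable_mult_right integrable_real_indicator)
      (auto simp: emeasure_eq_measure)
  have "norm (expectation f - expectation g) = norm (expectation (\<lambda>w. f w - g w))"
    using int by simp
  also have "\<dots> \<le> expectation (\<lambda>w. norm (f w - g w))" by (rule integral_norm_bound)
  also have "\<dots> \<le> expectation (\<lambda>w. e + 2 * indicator B w)"
  proof (rule integral_mono[OF _ intb])
    show "integrable M (\<lambda>w. norm (f w - g w))" using int by simp
    fix w assume w: "w \<in> space M"
    show "norm (f w - g w) \<le> e + 2 * indicator B w"
    proof (cases "w \<in> B")
      case True
      have "norm (f w - g w) \<le> 1 + 1" using bd[OF w] by (meson add_mono norm_triangle_le_diff)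
      then show ?thesis using True e by simp
    qed (use close[OF w] in simp)
  qed
  also have "\<dots> = e + 2 * prob B"
    by (subst Bochner_Integration.integral_add) (auto simp: prob_space emeasure_eq_measure)
  finally show ?thesis .
qed

lemma norm_iexp_diff: "cmod (iexp x - iexp y) \<le> \<bar>x - y\<bar>"
proof -
  have "iexp x - iexp y = iexp y * (iexp (x - y) - 1)"
    by (simp add: algebra_simps flip: exp_add)
  then have "cmod (iexp x - iexp y) = cmod (iexp (x - y) - 1)" by (simp add: norm_mult)
  also have "\<dots> \<le> \<bar>x - y\<bar>" using iexp_approx1[of "x - y" 0] by simp
  finally show ?thesis .
qed

lemma abs_exp_minus_diff:
  fixes x y :: real
  assumes "0 \<le> x" "0 \<le> y"
  shows "\<bar>exp (- x) - exp (- y)\<bar> \<le> \<bar>x - y\<bar>"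
proof -
  have *: "exp (- x) - exp (- y) \<le> y - x \<and> 0 \<le> exp (- x) - exp (- y)" if "0 \<le> x" "x \<le> y" for x y :: real
  proof -
    have "exp (- x) - exp (- y) = exp (- x) * (1 - exp (- (y - x)))"
      by (simp add: algebra_simps flip: exp_add)
    also have "\<dots> \<le> 1 * (y - x)"
    proof (rule mult_mono)
      show "1 - exp (- (y - x)) \<le> y - x" using exp_ge_add_one_self[of "- (y - x)"] by linarith
    qed (use that in auto)
    finally show ?thesis using that by simp
  qed
  show ?thesis using *[of x y] *[of y x] assms by (cases "x \<le> y") auto
qed

text \<open>Since x exp (-x) is at most 1, the derivative of exp (-a z) in a is at most 1/a in
  absolute value, uniformly in z. The coefficient in a Laplace transform can thus be changed without
  moment bounds on z.\<close>

lemma abs_exp_minus_scale_diff: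
  fixes a b z :: real
  assumes "0 < c" "c \<le> a" "c \<le> b" "0 \<le> z"
  shows "\<bar>exp (- (a * z)) - exp (- (b * z))\<bar> \<le> \<bar>a - b\<bar> / c"
proof -
  have *: "\<bar>exp (- (a * z)) - exp (- (b * z))\<bar> \<le> \<bar>a - b\<bar> / c" if "a \<le> b" "c \<le> a" for a b
  proof -
    have ab: "a * z \<le> b * z" using that assms by (intro mult_right_mono) auto
    have "exp (- (a * z)) - exp (- (b * z)) = exp (- (a * z)) * (1 - exp (- ((b - a) * z)))"
      by (simp add: algebra_simps flip: exp_add)
    also have "\<dots> \<le> exp (- (a * z)) * ((b - a) * z)"
      using exp_ge_add_one_self[of "- ((b - a) * z)"] by (intro mult_left_mono) auto
    also have "\<dots> = exp (- (a * z)) * (a * z) * ((b - a) / a)"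
      using that assms by (simp add: field_simps)
    also have "\<dots> \<le> 1 * ((b - a) / a)"
    proof (rule mult_right_mono)
      have "a * z \<le> exp (a * z)" using exp_ge_add_one_self[of "a * z"] by linarith
      then show "exp (- (a * z)) * (a * z) \<le> 1" by (simp add: exp_minus field_simps)
    qed (use that assms in auto)
    also have "\<dots> \<le> (b - a) / c" using that assms by (simp add: frac_le)
    finally show ?thesis using ab that by simp
  qed
  show ?thesis using *[of a b] *[of b a] assms by (cases "a \<le> b") (auto simp: abs_minus_commute)
qed

section \<open>Characteristic functions of signed sums of scores\<close>

context label_streams
begin

text \<open>The variance of the score of one stream, sigma_R^2 for \<open>True\<close> and sigma_S^2
  for \<open>False\<close>, written through the laws so that it does not mention a position.\<close>

definition dvar :: "bool \<Rightarrow> real" where "dvar b = (\<Sum>i. law b i * (cscore b i)\<^sup>2)"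

definition sig2 :: real where "sig2 = dvar True + dvar False"

lemma abs_cscore_sq_le_1: "\<bar>(cscore b x)\<^sup>2\<bar> \<le> 1"
  using abs_cscore_le_1[of b x] by (simp add: abs_square_le_1)

lemma expectation_dev_sq: "1 \<le> snd p \<Longrightarrow> expectation (\<lambda>w. (dev p w)\<^sup>2) = dvar (fst p)"
  unfolding dev_def dvar_def
  by (erule expectation_label[where B=1 and g="\<lambda>x. (cscore (fst p) x)\<^sup>2"]) (rule abs_cscore_sq_le_1)

lemma char_signed_dev:
  assumes p: "1 \<le> snd p" and c: "\<bar>c\<bar> = 1"
  shows "cmod (char (distr M borel (\<lambda>w. c * dev p w)) t - exp (- (t\<^sup>2 * dvar (fst p) / 2))) \<le> \<bar>t\<bar>^3 / 6 + t^4 / 8"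
proof -
  have [measurable]: "dev p \<in> borel_measurable M" by (rule measurable_dev[OF p])
  have E0: "expectation (\<lambda>w. c * dev p w) = 0" by (simp add: expectation_dev[OF p])
  have "c\<^sup>2 = 1" using c by (metis power2_abs one_power2)
  then have v: "variance (\<lambda>w. c * dev p w) = dvar (fst p)"
    unfolding E0 using expectation_dev_sq[OF p] by (simp add: power_mult_distrib)
  have "\<bar>c * dev p w\<bar> \<le> 1" for w using abs_dev_le_1[of p w] c by (simp add: abs_mult)
  then show ?thesis
    using char_bounded_quadratic[OF _ _ E0, of t] unfolding v by simp
qed

text \<open>By independence the characteristic function is a product. All factors have modulus at
  most 1, so the errors of the single factors add up; signs do not affect the variances.\<close>

lemma char_signed_dev_sum:
  assumes A: "finite A" "A \<subseteq> UNIV \<times> {1..}" and c: "\<And>p. \<bar>c p\<bar> = 1"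
  shows "cmod (expectation (\<lambda>w. iexp (t * (\<Sum>p\<in>A. c p * dev p w))) - exp (- (t\<^sup>2 * (\<Sum>p\<in>A. dvar (fst p)) / 2)))
    \<le> real (card A) * (\<bar>t\<bar>^3 / 6 + t^4 / 8)"
proof -
  have p: "1 \<le> snd p" if "p \<in> A" for p using that A by auto
  have ind: "indep_vars (\<lambda>_. borel) (\<lambda>p w. c p * dev p w) A"
    by (rule indep_vars_compose2[OF indep_vars_subset[OF indep_dev A(2)]]) auto
  have rv: "(\<lambda>w. c p * dev p w) \<in> borel_measurable M" if "p \<in> A" for p
    using measurable_dev[OF p[OF that]] by simp
  have [measurable]: "(\<lambda>w. \<Sum>p\<in>A. c p * dev p w) \<in> borel_measurable M"
    by (intro borel_measurable_sum rv)
  have "expectation (\<lambda>w. iexp (t * (\<Sum>p\<in>A. c p * dev p w))) = char (distr M borel (\<lambda>w. \<Sum>p\<in>A. c p * dev p w)) t"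
    unfolding char_def by (subst integral_distr) auto
  also have "\<dots> = (\<Prod>p\<in>A. char (distr M borel (\<lambda>w. c p * dev p w)) t)"
    by (rule char_distr_sum[OF ind])
  finally have 1: "expectation (\<lambda>w. iexp (t * (\<Sum>p\<in>A. c p * dev p w))) = \<dots>" .
  have "exp (- (t\<^sup>2 * (\<Sum>p\<in>A. dvar (fst p)) / 2)) = (\<Prod>p\<in>A. exp (- (t\<^sup>2 * dvar (fst p) / 2)))"
    using A by (simp add: exp_sum sum_distrib_left sum_divide_distrib flip: sum_negf)
  then have 2: "complex_of_real (exp (- (t\<^sup>2 * (\<Sum>p\<in>A. dvar (fst p)) / 2))) = (\<Prod>p\<in>A. complex_of_real (exp (- (t\<^sup>2 * dvar (fst p) / 2))))"
    by (simp only: of_real_prod)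
  have dv: "0 \<le> dvar (fst p)" if "p \<in> A" for p
    using expectation_dev_sq[OF p[OF that]] by (metis integral_nonneg_AE AE_I2 zero_le_power2)
  have "cmod ((\<Prod>p\<in>A. char (distr M borel (\<lambda>w. c p * dev p w)) t) - (\<Prod>p\<in>A. complex_of_real (exp (- (t\<^sup>2 * dvar (fst p) / 2)))))
     \<le> (\<Sum>p\<in>A. cmod (char (distr M borel (\<lambda>w. c p * dev p w)) t - exp (- (t\<^sup>2 * dvar (fst p) / 2))))"
  proof (rule norm_prod_diff)
    fix q assume q: "q \<in> A"
    interpret D: real_distribution "distr M borel (\<lambda>w. c q * dev q w)"
      by (rule real_distribution_distr) (use rv[OF q] in simp)
    show "cmod (char (distr M borel (\<lambda>w. c q * dev q w)) t) \<le> 1" by (rule D.cmod_char_le_1)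
    show "cmod (complex_of_real (exp (- (t\<^sup>2 * dvar (fst q) / 2)))) \<le> 1"
      using dv[OF q] by (simp add: norm_of_real)
  qed
  also have "\<dots> \<le> (\<Sum>p\<in>A. \<bar>t\<bar>^3 / 6 + t^4 / 8)"
    by (intro sum_mono char_signed_dev p c)
  finally show ?thesis unfolding 1 2 by simp
qed

text \<open>The labels exchanged by a shift d: the next |d| of the stream that gains records, R if d
  \<ge> 0, and the last |d| of the stream that loses them. The latter enter with sign -1.\<close>

definition swap_block :: "nat \<Rightarrow> int \<Rightarrow> (bool \<times> nat) set" where
  "swap_block m d = {d \<ge> 0} \<times> {m<..m + nat \<bar>d\<bar>} \<union> {\<not> d \<ge> 0} \<times> {m - nat \<bar>d\<bar><..m}"

definition swap_sign :: "int \<Rightarrow> bool \<times> nat \<Rightarrow> real" where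
  "swap_sign d p = (if fst p = (d \<ge> 0) then 1 else - 1)"

lemma swap_inc_eq_sum:
  assumes "\<bar>d\<bar> \<le> int m"
  shows "swap_inc (\<lambda>x. drift True x w) (\<lambda>x. drift False x w) m d = (\<Sum>p\<in>swap_block m d. swap_sign d p * dev p w)"
proof -
  let ?k = "nat \<bar>d\<bar>" and ?b = "d \<ge> 0"
  have "(\<Sum>p\<in>swap_block m d. swap_sign d p * dev p w) =
     (\<Sum>p\<in>{?b} \<times> {m<..m + ?k}. swap_sign d p * dev p w) + (\<Sum>p\<in>{\<not> ?b} \<times> {m - ?k<..m}. swap_sign d p * dev p w)"
    unfolding swap_block_def by (rule sum.union_disjoint) auto
  also have "(\<Sum>p\<in>{?b} \<times> {m<..m + ?k}. swap_sign d p * dev p w) = (\<Sum>p\<in>{?b} \<times> {m<..m + ?k}. dev p w)"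
    by (rule sum.cong) (auto simp: swap_sign_def)
  also have "\<dots> = drift ?b (m + ?k) w - drift ?b m w" by (simp add: drift_diff)
  also have "(\<Sum>p\<in>{\<not> ?b} \<times> {m - ?k<..m}. swap_sign d p * dev p w) = (\<Sum>p\<in>{\<not> ?b} \<times> {m - ?k<..m}. - dev p w)"
    by (rule sum.cong) (auto simp: swap_sign_def)
  also have "\<dots> = - (drift (\<not> ?b) m w - drift (\<not> ?b) (m - ?k) w)" by (simp add: drift_diff sum_negf)
  finally have e: "(\<Sum>p\<in>swap_block m d. swap_sign d p * dev p w) =
     (drift ?b (m + ?k) w - drift ?b m w) - (drift (\<not> ?b) m w - drift (\<not> ?b) (m - ?k) w)" by simp
  show ?thesis
  proof (cases ?b)
    case True
    then have "nat (int m + d) = m + ?k" "nat (int m - d) = m - ?k" using assms by auto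
    then show ?thesis unfolding e using True by (simp add: swap_inc_def)
  next
    case False
    then have "nat (int m + d) = m - ?k" "nat (int m - d) = m + ?k" using assms by auto
    then show ?thesis unfolding e using False by (simp add: swap_inc_def)
  qed
qed

text \<open>The block avoids all positions up to m - l, which gives independence from the proxy. It
  has |d| labels of each stream, whatever the sign of d, hence total variance |d|
  \<open>sig2\<close>.\<close>

lemma swap_block_props:
  assumes "\<bar>d\<bar> \<le> int l" "l \<le> m"
  shows "finite (swap_block m d)" "swap_block m d \<subseteq> UNIV \<times> {m - l<..m + l}"
    "real (card (swap_block m d)) = 2 * real_of_int \<bar>d\<bar>"
    "(\<Sum>p\<in>swap_block m d. dvar (fst p)) = real_of_int \<bar>d\<bar> * sig2"
proof -
  let ?k = "nat \<bar>d\<bar>" and ?b = "d \<ge> 0"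
  show "finite (swap_block m d)" by (simp add: swap_block_def)
  show "swap_block m d \<subseteq> UNIV \<times> {m - l<..m + l}" using assms by (auto simp: swap_block_def)
  have s: "(\<Sum>p\<in>swap_block m d. f (fst p)) = real ?k * f ?b + real ?k * f (\<not> ?b)" for f :: "bool \<Rightarrow> real"
  proof -
    have "(\<Sum>p\<in>swap_block m d. f (fst p)) = (\<Sum>p\<in>{?b} \<times> {m<..m + ?k}. f (fst p)) + (\<Sum>p\<in>{\<not> ?b} \<times> {m - ?k<..m}. f (fst p))"
      unfolding swap_block_def by (rule sum.union_disjoint) auto
    also have "(\<Sum>p\<in>{?b} \<times> {m<..m + ?k}. f (fst p)) = (\<Sum>p\<in>{?b} \<times> {m<..m + ?k}. f ?b)"
      by (rule sum.cong) auto
    also have "(\<Sum>p\<in>{\<not> ?b} \<times> {m - ?k<..m}. f (fst p)) = (\<Sum>p\<in>{\<not> ?b} \<times> {m - ?k<..m}. f (\<not> ?b))"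
      by (rule sum.cong) auto
    finally show ?thesis using assms by (simp add: card_cartesian_product)
  qed
  show "real (card (swap_block m d)) = 2 * real_of_int \<bar>d\<bar>" using s[of "\<lambda>_. 1"] by simp
  show "(\<Sum>p\<in>swap_block m d. dvar (fst p)) = real_of_int \<bar>d\<bar> * sig2"
    using s[of dvar] by (cases ?b) (simp_all add: sig2_def algebra_simps)
qed

text \<open>Only the first m - l labels of each stream enter, and these are disjoint from every
  block a shift within the window can exchange.\<close>

definition proxy_shift :: "nat \<Rightarrow> nat \<Rightarrow> 'a \<Rightarrow> int" where
  "proxy_shift m l w = clamp_shift mu l (drift False (m - l) w - drift True (m - l) w)"

lemma abs_clamp_shift_le: "\<bar>clamp_shift u l x\<bar> \<le> int l"
  by (auto simp: clamp_shift_def)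

lemma measurable_clamp_shift[measurable]: "clamp_shift u l \<in> measurable borel (count_space UNIV)"
  unfolding clamp_shift_def[abs_def] by measurable

lemma measurable_proxy_shift[measurable]: "proxy_shift m l \<in> measurable M (count_space UNIV)"
  unfolding proxy_shift_def[abs_def] by measurable

text \<open>Freezing the labels up to m - l fixes the shift d. The exchange is then a signed sum of
  2 |d| independent terms with variance |d| \<open>sig2\<close>, approximately Gaussian with an
  error proportional to 2 |d|, at most 2 l. Averaging over d yields a Laplace transform of
  |d|.\<close>

lemma char_swap_inc:
  assumes l: "l \<le> m"
  shows "cmod (expectation (\<lambda>w. iexp (t * swap_inc (\<lambda>x. drift True x w) (\<lambda>x. drift False x w) m (proxy_shift m l w)))
      - expectation (\<lambda>w. exp (- (t\<^sup>2 * (real_of_int \<bar>proxy_shift m l w\<bar> * sig2) / 2))))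
    \<le> 2 * real l * (\<bar>t\<bar>^3 / 6 + t^4 / 8)"
proof -
  let ?J = "UNIV \<times> {m-l<..m+l} :: (bool \<times> nat) set" and ?K = "UNIV \<times> {1..m-l} :: (bool \<times> nat) set"
  let ?N = "\<lambda>J :: (bool \<times> nat) set. PiM J (\<lambda>_. count_space (UNIV :: nat set))"
  let ?x = "\<lambda>v. (\<Sum>j=1..m-l. cscore False (v (False, j))) - (\<Sum>j=1..m-l. cscore True (v (True, j)))"
  let ?dl = "\<lambda>v. clamp_shift mu l (?x v)"
  let ?S = "\<lambda>d u. \<Sum>p\<in>swap_block m d. swap_sign d p * cscore (fst p) (u p)"
  let ?F = "\<lambda>(u, v). iexp (t * ?S (?dl v) u)"
  let ?phi = "\<lambda>d. expectation (\<lambda>w. iexp (t * (\<Sum>p\<in>swap_block m d. swap_sign d p * dev p w)))"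
  have comp: "(\<lambda>v. cscore b (v p)) \<in> borel_measurable (?N J)" if "p \<in> J" for b p and J :: "(bool \<times> nat) set"
    by (rule measurable_compose[OF measurable_component_singleton[OF that]]) simp
  have [measurable]: "?x \<in> borel_measurable (?N ?K)"
    by (intro borel_measurable_diff borel_measurable_sum comp) auto
  have pw: "p \<in> ?J" if "p \<in> swap_block m d" "\<bar>d\<bar> \<le> int l" for p d
    using swap_block_props(2)[OF that(2) l] that(1) by blast
  have FS: "(\<lambda>u. ?S d u) \<in> borel_measurable (?N ?J)" if "\<bar>d\<bar> \<le> int l" for d
    by (intro borel_measurable_sum borel_measurable_times borel_measurable_const comp pw[OF _ that])
  have F: "?F \<in> borel_measurable (?N ?J \<Otimes>\<^sub>M ?N ?K)"
  proof -
    \<comment> \<open>A block is covered by \<open>?J\<close> only for |d| \<le> l. Clamping once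
      more makes the countable case split valid for all integers d, and it leaves the value of
      \<open>clamp_shift\<close> unchanged.\<close>
    let ?cl = "\<lambda>d. max (- int l) (min (int l) d)"
    have cl: "\<bar>?cl d\<bar> \<le> int l" for d by auto
    have cd: "?cl (?dl v) = ?dl v" for v by (auto simp: clamp_shift_def)
    have "(\<lambda>z. iexp (t * ?S (?cl (?dl (snd z))) (fst z))) \<in> borel_measurable (?N ?J \<Otimes>\<^sub>M ?N ?K)"
    proof (rule measurable_compose_countable'[where f="\<lambda>d z. iexp (t * ?S (?cl d) (fst z))" and g="\<lambda>z. ?dl (snd z)" and I=UNIV])
      fix d :: int
      have [measurable]: "(\<lambda>z. ?S (?cl d) (fst z)) \<in> borel_measurable (?N ?J \<Otimes>\<^sub>M ?N ?K)"
        by (rule measurable_compose[OF measurable_fst FS[OF cl]])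
      show "(\<lambda>z. iexp (t * ?S (?cl d) (fst z))) \<in> borel_measurable (?N ?J \<Otimes>\<^sub>M ?N ?K)" by measurable
    qed auto
    then show ?thesis unfolding cd by (simp add: case_prod_unfold)
  qed
  have dlw: "?dl (\<lambda>p\<in>?K. label p w) = proxy_shift m l w" for w
    by (simp add: proxy_shift_def drift_def dev_def)
  have Sw: "?S d (\<lambda>p\<in>?J. label p w) = (\<Sum>p\<in>swap_block m d. swap_sign d p * dev p w)" if "\<bar>d\<bar> \<le> int l" for d w
    by (rule sum.cong) (use pw[OF _ that] in \<open>auto simp: dev_def\<close>)
  have "expectation (\<lambda>w. iexp (t * swap_inc (\<lambda>x. drift True x w) (\<lambda>x. drift False x w) m (proxy_shift m l w)))
      = (\<integral>w. ?F (\<lambda>p\<in>?J. label p w, \<lambda>p\<in>?K. label p w) \<partial>M)"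
  proof (rule Bochner_Integration.integral_cong[OF refl])
    fix w
    have b: "\<bar>proxy_shift m l w\<bar> \<le> int l" by (simp add: proxy_shift_def abs_clamp_shift_le)
    have b': "\<bar>proxy_shift m l w\<bar> \<le> int m" using b l by linarith
    show "iexp (t * swap_inc (\<lambda>x. drift True x w) (\<lambda>x. drift False x w) m (proxy_shift m l w))
      = ?F (\<lambda>p\<in>?J. label p w, \<lambda>p\<in>?K. label p w)"
      unfolding prod.case dlw Sw[OF b] swap_inc_eq_sum[OF b'] ..
  qed
  also have "\<dots> = (\<integral>w. ?phi (?dl (\<lambda>p\<in>?K. label p w)) \<partial>M)"
  proof (rule expectation_indep_pair[OF indep_label_blocks F, where B=1])
    fix v
    show "(\<integral>w. ?F (\<lambda>p\<in>?J. label p w, v) \<partial>M) = ?phi (?dl v)"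
      unfolding prod.case Sw[OF abs_clamp_shift_le] ..
  qed (auto simp: case_prod_unfold)
  also have "\<dots> = (\<integral>w. ?phi (proxy_shift m l w) \<partial>M)" unfolding dlw ..
  finally have 1: "expectation (\<lambda>w. iexp (t * swap_inc (\<lambda>x. drift True x w) (\<lambda>x. drift False x w) m (proxy_shift m l w))) = \<dots>" .
  let ?c = "2 * real l * (\<bar>t\<bar>^3 / 6 + t^4 / 8)"
  have phi: "cmod (?phi d - exp (- (t\<^sup>2 * (real_of_int \<bar>d\<bar> * sig2) / 2))) \<le> ?c" if d: "\<bar>d\<bar> \<le> int l" for d
  proof -
    have sb: "swap_block m d \<subseteq> UNIV \<times> {1..}" using swap_block_props(2)[OF d l] by auto
    have "cmod (?phi d - exp (- (t\<^sup>2 * (real_of_int \<bar>d\<bar> * sig2) / 2))) \<le> 2 * real_of_int \<bar>d\<bar> * (\<bar>t\<bar>^3 / 6 + t^4 / 8)"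
      using char_signed_dev_sum[OF swap_block_props(1)[OF d l] sb, of "swap_sign d" t]
      unfolding swap_block_props(3,4)[OF d l] by (simp add: swap_sign_def)
    also have "\<dots> \<le> ?c" using d by (intro mult_right_mono) auto
    finally show ?thesis .
  qed
  have s0: "0 \<le> sig2"
    unfolding sig2_def dvar_def
    by (intro add_nonneg_nonneg suminf_nonneg) (auto simp: law_nonneg intro!: sums_summable[OF label_expectation_sums[of "(_, 1)", simplified]] abs_cscore_sq_le_1)
  have "norm (expectation (\<lambda>w. ?phi (proxy_shift m l w)) - expectation (\<lambda>w. complex_of_real (exp (- (t\<^sup>2 * (real_of_int \<bar>proxy_shift m l w\<bar> * sig2) / 2)))))
     \<le> ?c + 2 * prob {}"
  proof (rule expectation_diff_le)
    show "(\<lambda>w. ?phi (proxy_shift m l w)) \<in> borel_measurable M"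
      by (rule measurable_compose[OF measurable_proxy_shift]) simp
    show "cmod (?phi (proxy_shift m l w)) \<le> 1" for w
      by (rule order_trans[OF integral_norm_bound]) (simp add: prob_space)
    show "cmod (?phi (proxy_shift m l w) - complex_of_real (exp (- (t\<^sup>2 * (real_of_int \<bar>proxy_shift m l w\<bar> * sig2) / 2)))) \<le> ?c" for w
      by (rule phi) (simp add: proxy_shift_def abs_clamp_shift_le)
  qed (use s0 in \<open>auto simp: norm_of_real\<close>)
  then show ?thesis unfolding 1 by simp
qed

section \<open>Central limit theorem for the difference of the walks\<close>

lemma distr_label: 
  assumes "1 \<le> snd p" "1 \<le> snd q" "fst p = fst q"
  shows "distr M (count_space UNIV) (label p) = distr M (count_space UNIV) (label q)"
proof (rule measure_eqI_countable[where A=UNIV])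
  fix a :: nat
  have "label p -` {a} \<inter> space M = {w \<in> space M. label p w = a}" for p by auto
  then show "emeasure (distr M (count_space UNIV) (label p)) {a} = emeasure (distr M (count_space UNIV) (label q)) {a}"
    using assms by (simp add: emeasure_distr measurable_label emeasure_eq_measure prob_label)
qed auto

lemma indep_var_labels:
  assumes "1 \<le> snd p" "1 \<le> snd q" "p \<noteq> q"
  shows "indep_var (count_space UNIV) (label p) (count_space UNIV) (label q)"
proof -
  have "indep_var (PiM {p} (\<lambda>_. count_space UNIV)) (\<lambda>w. \<lambda>p\<in>{p}. label p w) (PiM {q} (\<lambda>_. count_space UNIV)) (\<lambda>w. \<lambda>p\<in>{q}. label p w)"
    using assms by (intro indep_label_blocks) (auto simp: mem_Times_iff)
  from indep_var_compose[OF this, of "\<lambda>v. v p" "count_space UNIV" "\<lambda>v. v q" "count_space UNIV"]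
  show ?thesis by (simp add: comp_def measurable_component_singleton)
qed

text \<open>Pairing the labels of both streams at equal positions gives i.i.d. centred terms. The
  cross term has mean 0 by independence, so each has variance \<open>sig2\<close> and the classical
  theorem applies.\<close>

lemma drift_difference_CLT:
  assumes s: "0 < sig2"
  shows "weak_conv_m (\<lambda>k. distr M borel (\<lambda>w. (drift False k w - drift True k w) / sqrt (real k * sig2))) std_normal_distribution"
proof -
  define X where "X j w = dev (False, Suc j) w - dev (True, Suc j) w" for j w
  have [measurable]: "dev (b, Suc j) \<in> borel_measurable M" for b j by (rule measurable_dev) simp
  have bi: "integrable M (dev (b, Suc j))" for b j
    by (rule integrable_const_bound[where B=1]) (auto simp: abs_dev_le_1)
  have bi2: "integrable M (\<lambda>w. dev (b, Suc j) w * dev (b', Suc j) w)" for b b' j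
  proof (rule integrable_const_bound[where B="1 * 1"])
    show "AE w in M. norm (dev (b, Suc j) w * dev (b', Suc j) w) \<le> 1 * 1"
      unfolding real_norm_def by (intro AE_I2 abs_mult_le abs_dev_le_1)
  qed auto
  have ind: "indep_vars (\<lambda>_. borel) X UNIV"
  proof -
    let ?K = "\<lambda>j. {(False, Suc j), (True, Suc j)}"
    have "indep_vars (\<lambda>j. PiM (?K j) (\<lambda>_. count_space UNIV)) (\<lambda>j w. \<lambda>p\<in>?K j. label p w) UNIV"
      by (rule indep_vars_restrict[OF indep_labels]) (auto simp: disjoint_family_on_def)
    from indep_vars_compose2[OF this, of "\<lambda>j v. cscore False (v (False, Suc j)) - cscore True (v (True, Suc j))" "\<lambda>_. borel"]
    have "indep_vars (\<lambda>_. borel) (\<lambda>j w. cscore False (label (False, Suc j) w) - cscore True (label (True, Suc j) w)) UNIV"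
      by (auto intro!: borel_measurable_diff measurable_compose[OF measurable_component_singleton])
    then show ?thesis by (simp add: X_def[abs_def] dev_def)
  qed
  have mean: "expectation (X j) = 0" for j
    unfolding X_def[abs_def] using bi expectation_dev by simp
  have cross: "expectation (\<lambda>w. dev (False, Suc j) w * dev (True, Suc j) w) = 0" for j
  proof -
    let ?F = "\<lambda>(x, y). cscore False x * cscore True y"
    have "(\<integral>w. ?F (label (False, Suc j) w, label (True, Suc j) w) \<partial>M) = (\<integral>w. 0 \<partial>M)"
    proof (rule expectation_indep_pair[OF indep_var_labels, where B="1*1"])
      show "norm (?F z) \<le> 1 * 1" for z
        unfolding case_prod_unfold real_norm_def by (intro abs_mult_le abs_cscore_le_1)
      show "?F \<in> borel_measurable (count_space UNIV \<Otimes>\<^sub>M count_space UNIV)" by (simp add: pair_measure_countable)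
    qed (use expectation_cscore[of "(False, Suc j)"] in auto)
    then show ?thesis by (simp add: dev_def)
  qed
  have sq: "(X j w)\<^sup>2 = dev (False, Suc j) w * dev (False, Suc j) w + dev (True, Suc j) w * dev (True, Suc j) w - 2 * (dev (False, Suc j) w * dev (True, Suc j) w)" for j w
    by (simp add: X_def power2_eq_square algebra_simps)
  have sqi: "integrable M (\<lambda>w. (X j w)\<^sup>2)" for j
    unfolding sq using bi2 by simp
  have var: "variance (X j) = (sqrt sig2)\<^sup>2" for j
  proof -
    have "variance (X j) = expectation (\<lambda>w. (X j w)\<^sup>2)" by (simp add: mean)
    also have "\<dots> = dvar False + dvar True - 2 * 0"
      unfolding sq using bi2 cross[of j] expectation_dev_sq[of "(False, Suc j)"] expectation_dev_sq[of "(True, Suc j)"]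
      by (simp add: power2_eq_square)
    finally show ?thesis using s by (simp add: sig2_def)
  qed
  have dist: "distr M borel (X j) = distr M borel (X 0)" for j
  proof -
    let ?h = "\<lambda>(x, y). cscore False x - cscore True y"
    let ?C = "count_space UNIV :: nat measure"
    have hm: "?h \<in> borel_measurable (?C \<Otimes>\<^sub>M ?C)" by (simp add: pair_measure_countable)
    have "distr M borel (X j) = distr (distr M ?C (label (False, 1)) \<Otimes>\<^sub>M distr M ?C (label (True, 1))) borel ?h" for j
    proof -
      have lm: "label (False, Suc j) \<in> measurable M ?C" "label (True, Suc j) \<in> measurable M ?C"
        by (auto intro: measurable_label)
      have "distr M borel (X j) = distr (distr M (?C \<Otimes>\<^sub>M ?C) (\<lambda>w. (label (False, Suc j) w, label (True, Suc j) w))) borel ?h"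
        by (subst distr_distr[OF hm]) (auto simp: comp_def X_def[abs_def] dev_def intro!: measurable_Pair lm)
      also have "distr M (?C \<Otimes>\<^sub>M ?C) (\<lambda>w. (label (False, Suc j) w, label (True, Suc j) w))
         = distr M ?C (label (False, Suc j)) \<Otimes>\<^sub>M distr M ?C (label (True, Suc j))"
        using indep_var_labels[of "(False, Suc j)" "(True, Suc j)"] by (simp add: indep_var_distribution_eq)
      also have "distr M ?C (label (False, Suc j)) = distr M ?C (label (False, 1))" by (rule distr_label) auto
      also have "distr M ?C (label (True, Suc j)) = distr M ?C (label (True, 1))" by (rule distr_label) auto
      finally show ?thesis .
    qed
    then show ?thesis by metis
  qed
  have "weak_conv_m (\<lambda>k. distr M borel (\<lambda>w. (\<Sum>i<k. X i w) / sqrt (real k * (sqrt sig2)\<^sup>2))) std_normal_distribution"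
    by (rule central_limit_theorem_zero_mean[OF ind mean _ sqi var dist]) (use s in simp)
  moreover have "(\<Sum>i<k. X i w) = drift False k w - drift True k w" for k w
    by (simp add: X_def drift_def sum.atLeast1_atMost_eq sum_subtractf)
  ultimately show ?thesis using s by simp
qed

text \<open>For c \<ge> 0 the function exp (-c |x|) is bounded and continuous, so weak convergence
  transfers to its integrals.\<close>

lemma drift_difference_Laplace:
  assumes s: "0 < sig2" and c: "0 \<le> c"
  shows "(\<lambda>k. expectation (\<lambda>w. exp (- (c * \<bar>(drift False k w - drift True k w) / sqrt (real k * sig2)\<bar>))))
     \<longlonglongrightarrow> (LINT x|std_normal_distribution. exp (- (c * \<bar>x\<bar>)))"
proof -
  let ?Z = "\<lambda>k w. (drift False k w - drift True k w) / sqrt (real k * sig2)"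
  have "(\<lambda>k. integral\<^sup>L (distr M borel (?Z k)) (\<lambda>x. exp (- (c * \<bar>x\<bar>)))) \<longlonglongrightarrow> integral\<^sup>L std_normal_distribution (\<lambda>x. exp (- (c * \<bar>x\<bar>)))"
  proof (rule weak_conv_imp_integral_bdd_continuous_conv[OF _ _ drift_difference_CLT[OF s]])
    show "real_distribution (distr M borel (?Z k))" for k by (rule real_distribution_distr) simp
    show "real_distribution std_normal_distribution" by (rule real_dist_normal_dist)
    show "norm (exp (- (c * \<bar>x\<bar>))) \<le> 1" for x using c by simp
  qed (auto intro!: continuous_intros)
  then show ?thesis by (simp add: integral_distr)
qed

end

section \<open>The limit law\<close>

text \<open>In units of 1/64 the exponents of the summands are 33, 67, 65, 68, 79, 65 and 74,
  against 80 in the denominator. The second claim compares 33 with the exponent 34 of the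
  window.\<close>

lemma path_error_asymptotics:
  fixes u :: real
  defines "W \<equiv> \<lambda>n. real_of_int \<lfloor>real n powr (17/32)\<rfloor>"
  assumes "0 < u"
  shows "(\<lambda>n. (2 * (real n powr (1/64) * sqrt (real n) + 2 * (W n * (real n powr (1/64) * sqrt (real n))) + real n * real n powr (1/64)
       + W n * (W n + 1) + real n powr (79/64))
     + real n * real n powr (1/64)
     + real n * real n powr (1/64) * sqrt (1 + (2 + 2 * (real n powr (1/64) * sqrt (2 * W n + 1))) / (2 * u))) / real n powr (5/4)) \<longlonglongrightarrow> 0"
    and "eventually (\<lambda>n. (2 + 2 * (real n powr (1/64) * sqrt (real n))) / (2 * u) + 1 \<le> W n) sequentially"
  using assms(2) unfolding W_def by real_asymp+

text \<open>The leading exponent is 17/32 - 3/4 = -7/32.\<close>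

lemma char_error_asymptotics:
  fixes b :: real
  assumes "0 < b"
  shows "(\<lambda>n. 2 * real_of_int \<lfloor>real n powr (17/32)\<rfloor> * ((b / 2 * real n powr (-1/4)) ^ 3 / 6
     + (b / 2 * real n powr (-1/4)) ^ 4 / 8)) \<longlonglongrightarrow> 0"
  using assms by real_asymp

lemma inverse_sqrt_asymptotics: "(\<lambda>n. a / (8 * sqrt (real n))) \<longlonglongrightarrow> 0" for a :: real
  by real_asymp

context label_streams
begin

text \<open>
  Exponents: \<open>n\<^bsup>1/64\<^esup>\<close> is the slack in the modulus of continuity of the walks, \<open>17/32 = 1/2 + 2/64\<close> leaves room for
  the displacement \<open>n\<^bsup>1/2 + 1/64\<^esup> / mu\<close> that this slack permits, and \<open>79/64 = 5/4 - 1/64\<close> bounds the kernel sums.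
\<close>

definition window :: "nat \<Rightarrow> nat" where "window n = nat \<lfloor>real n powr (17/32)\<rfloor>"

definition bad_event :: "nat \<Rightarrow> 'a set" where
  "bad_event n = {w\<in>space M. \<not> smooth_drift n (real n powr (1/64)) w} \<union>
     {w\<in>space M. \<not> smooth_Hsum n (n div 2) (window n) (real n powr (79/64)) w}"

text \<open>The leading term n/2 times the exchange, divided by n^(5/4), with the true displacement
  replaced by the proxy.\<close>

definition limit_proxy :: "nat \<Rightarrow> 'a \<Rightarrow> real" where
  "limit_proxy n w = real n powr (-1/4) / 2 *
     swap_inc (\<lambda>x. drift True x w) (\<lambda>x. drift False x w) (n div 2) (proxy_shift (n div 2) (window n) w)"

text \<open>The bound of \<open>balanced_minus_middle\<close> with e = n^(1/64) and t = n^(79/64),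
  divided by n^(5/4).\<close>

definition path_error :: "nat \<Rightarrow> real" where
  "path_error n = (2 * (real n powr (1/64) * sqrt n + 2 * (real (window n) * (real n powr (1/64) * sqrt n)) + real n * real n powr (1/64)
       + real (window n) * (real (window n) + 1) + real n powr (79/64))
     + real n * real n powr (1/64)
     + real n * real n powr (1/64) * sqrt (1 + (2 + 2 * (real n powr (1/64) * sqrt (2 * real (window n) + 1))) / (2 * mu))) / real n powr (5/4)"

lemma real_window: "real (window n) = real_of_int \<lfloor>real n powr (17/32)\<rfloor>"
  by (simp add: window_def)

lemma real_half: "real (n div 2) = real_of_int \<lfloor>real n / 2\<rfloor>"
  by (simp add: floor_divide_of_nat_eq[of n 2, simplified])

lemma bad_event_measurable[measurable]: "bad_event n \<in> sets M" if "n \<ge> 1"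
  unfolding bad_event_def using that
  by (intro sets.Un prob_not_smooth_drift prob_not_smooth_Hsum) auto

text \<open>The walks contribute n^2 exp (-2 n^(1/32)) up to a constant; the kernel sums contribute
  l^2 n / t^2, of order n^(-13/32).\<close>

lemma prob_bad_event_tendsto_0: "(\<lambda>n. prob (bad_event n)) \<longlonglongrightarrow> 0"
proof (rule tendsto_sandwich[where f="\<lambda>_. 0"])
  let ?g = "\<lambda>n. 4 * (real n + 1)\<^sup>2 * exp (- 2 * (real n powr (1/64))\<^sup>2)
     + (2 * real (window n) + 1) * (4 * (real n * real (window n)) / (real n powr (79/64))\<^sup>2)"
  show "\<forall>\<^sub>F n in sequentially. prob (bad_event n) \<le> ?g n"
    using eventually_ge_at_top[of 1]
  proof eventually_elim
    case (elim n)
    have "prob (bad_event n) \<le> prob {w\<in>space M. \<not> smooth_drift n (real n powr (1/64)) w}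
        + prob {w\<in>space M. \<not> smooth_Hsum n (n div 2) (window n) (real n powr (79/64)) w}"
      unfolding bad_event_def
      by (intro measure_Un_le prob_not_smooth_drift(1) prob_not_smooth_Hsum(1)) (use elim in auto)
    also have "\<dots> \<le> ?g n"
      by (intro add_mono prob_not_smooth_drift(2) prob_not_smooth_Hsum(2)) (use elim in auto)
    finally show ?case .
  qed
  show "?g \<longlonglongrightarrow> 0" unfolding real_window by real_asymp
qed auto

lemma path_error_tendsto_0: "0 < mu \<Longrightarrow> path_error \<longlonglongrightarrow> 0"
  unfolding path_error_def[abs_def] real_window by (rule path_error_asymptotics)

lemma eventually_window:
  assumes "0 < mu"
  shows "eventually (\<lambda>n. 1 \<le> n \<and> 1 \<le> window n \<and> window n \<le> n div 2 \<and>
     (2 + 2 * (real n powr (1/64) * sqrt n)) / (2 * mu) + 1 \<le> real (window n)) sequentially"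
proof -
  have "eventually (\<lambda>n. (2 + 2 * (real n powr (1/64) * sqrt n)) / (2 * mu) + 1 \<le> real (window n)) sequentially"
    unfolding real_window using assms by (rule path_error_asymptotics)
  moreover have "eventually (\<lambda>n. real (window n) + 1 \<le> real n / 2) sequentially"
    unfolding real_window by real_asymp
  moreover have "eventually (\<lambda>n. 1 \<le> real (window n)) sequentially"
    unfolding real_window by real_asymp
  ultimately show ?thesis using eventually_ge_at_top[of 1]
  proof eventually_elim
    case (elim n)
    then have "2 * window n + 2 \<le> n" by linarith
    then show ?case using elim by auto
  qed
qed

text \<open>A pathwise application of \<open>balanced_minus_middle\<close>: the greedy count is the
  balanced split point, the alternating count is the one next to the middle.\<close>

lemma match_difference_close:
  assumes mu: "0 < mu" and F0: "greedy_policy M F0 r s LR LS CG" "alternating_policy M F0 LR LS CA"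
    and n: "1 \<le> n" "1 \<le> window n" "window n \<le> n div 2"
      "(2 + 2 * (real n powr (1/64) * sqrt n)) / (2 * mu) + 1 \<le> real (window n)"
    and w: "w \<in> space M" "w \<notin> bad_event n"
  shows "\<bar>(real (matches LR LS CG n w) - real (matches LR LS CA n w)) / real n powr (5/4) - limit_proxy n w\<bar> \<le> path_error n"
proof -
  let ?DR = "\<lambda>x. drift True x w" and ?DS = "\<lambda>x. drift False x w" and ?H = "\<lambda>x. Hsum x (n - x) w"
  let ?e = "real n powr (1/64)" and ?m = "n div 2" and ?l = "window n"
  let ?I = "swap_inc ?DR ?DS ?m (proxy_shift ?m ?l w)"
  let ?a = "Rcnt CG n w" and ?a' = "Rcnt CA n w"
  have sd: "smooth_drift n ?e w" and sh: "smooth_Hsum n ?m ?l (real n powr (79/64)) w"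
    using w by (auto simp: bad_event_def)
  have D: "root_mod n ?e ?DR" "root_mod n ?e ?DS"
    using sd by (auto simp: smooth_drift_def root_mod_def)
  have z: "?DR 0 = 0" "?DS 0 = 0" by (auto simp: drift_def)
  have nn: "n = 2 * ?m + n mod 2" "n mod 2 \<le> 1" by auto
  have r01: "0 \<le> r i" "r i \<le> 1" "0 \<le> s i" "s i \<le> 1" for i
    using law_nonneg[of True i] law_le_1[of True i] law_nonneg[of False i] law_le_1[of False i] by (auto simp: law_def)
  have bal: "\<bar>(?DR ?a + mu * real ?a) - (?DS (n - ?a) + mu * real (n - ?a))\<bar> \<le> 1"
    using greedy_balanced[OF F0(1) w(1) r01, of n] unfolding Gam_eq_drift Scnt_def .
  have H: "\<bar>?H x - ?H ?m\<bar> \<le> real n powr (79/64)" if "\<bar>int x - int ?m\<bar> \<le> int ?l" "x \<le> n" for x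
    using sh that by (auto simp: smooth_Hsum_def)
  define Mv where "Mv x = real (n - x) * ?DR x + real x * ?DS (n - x) + mu * real x * real (n - x) + ?H x" for x
  have mG: "real (matches LR LS CG n w) = Mv ?a" and mA: "real (matches LR LS CA n w) = Mv ?a'"
    unfolding Mv_def by (rule matches_decomposition[OF refl Rcnt_le])+
  have ps: "proxy_shift ?m ?l w = clamp_shift mu ?l (?DS (?m - ?l) - ?DR (?m - ?l))" by (simp add: proxy_shift_def)
  have "\<bar>Mv ?a - Mv ?a' - real n / 2 * ?I\<bar> \<le> path_error n * real n powr (5/4)"
  proof -
    have "real n powr (5/4) > 0" using n(1) by simp
    then have pe: "path_error n * real n powr (5/4) =
        2 * (?e * sqrt n + 2 * (real ?l * (?e * sqrt n)) + real n * ?e + real ?l * (real ?l + 1) + real n powr (79/64))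
        + real n * ?e + real n * ?e * sqrt (1 + (2 + 2 * (?e * sqrt (2 * real ?l + 1))) / (2 * mu))"
      unfolding path_error_def by simp
    show ?thesis unfolding pe ps Mv_def
      by (rule balanced_minus_middle[where H="?H" and p="n mod 2" and DR="?DR" and DS="?DS"])
        (use D z nn n mu mu_bounds H Rcnt_le bal alternating_middle[OF F0(2) w(1)] in \<open>simp_all\<close>)
  qed
  then have "\<bar>(Mv ?a - Mv ?a' - real n / 2 * ?I) / real n powr (5/4)\<bar> \<le> path_error n"
    using n(1) by (simp add: abs_divide divide_le_eq)
  moreover have "(Mv ?a - Mv ?a' - real n / 2 * ?I) / real n powr (5/4) = (Mv ?a - Mv ?a') / real n powr (5/4) - limit_proxy n w"
  proof -
    have "real n / real n powr (5/4) = real n powr (-1/4)"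
      using n(1) powr_diff[of "real n" 1 "5/4"] by simp
    moreover have "real n / 2 * ?I / real n powr (5/4) = real n / real n powr (5/4) / 2 * ?I" by simp
    ultimately have "real n / 2 * ?I / real n powr (5/4) = limit_proxy n w" by (simp only: limit_proxy_def)
    then show ?thesis by (simp add: diff_divide_distrib)
  qed
  ultimately show ?thesis unfolding mG mA by (simp only:)
qed

lemma measurable_limit_proxy[measurable]: "limit_proxy n \<in> borel_measurable M"
proof -
  have "(\<lambda>w. drift b (nat (f (proxy_shift (n div 2) (window n) w))) w) \<in> borel_measurable M" for b and f :: "int \<Rightarrow> int"
    by (rule measurable_compose_countable'[OF measurable_drift measurable_proxy_shift]) simp
  then show ?thesis unfolding limit_proxy_def[abs_def] swap_inc_def by measurable
qed

text \<open>Three replacements lead to the limit: the conditional characteristic function by a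
  Gaussian one (\<open>E1\<close>), the integer displacement by the normalised walk difference Z
  (\<open>E2\<close>), and the coefficient \<open>cn n\<close> by its limit c (\<open>E3\<close>).
  The central limit theorem treats what is left.\<close>

lemma char_limit_proxy:
  assumes mu: "0 < mu" and s: "0 < sig2"
  shows "(\<lambda>n. expectation (\<lambda>w. iexp (t * limit_proxy n w))) \<longlonglongrightarrow> char (mixF (sig2 ^ 3 / (128 * mu\<^sup>2))) t"
proof (cases "t = 0")
  \<comment> \<open>For t = 0 both sides are 1; otherwise c > 0, as the division in
    \<open>E3\<close> requires.\<close>
  case True
  interpret F: real_distribution "mixF (sig2 ^ 3 / (128 * mu\<^sup>2))" by (rule real_distribution_mixF)
  show ?thesis using True by (simp add: prob_space F.char_zero)
next
  case False
  define c where "c = t\<^sup>2 / 2 * sqrt (sig2 ^ 3 / (128 * mu\<^sup>2))"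
  define k where "k n = n div 2 - window n" for n
  define c' where "c' n = t\<^sup>2 * sig2 / (8 * sqrt (real n))" for n
  define cn where "cn n = c' n * sqrt (real (k n) * sig2) / (2 * mu)" for n
  define Z where "Z j w = (drift False j w - drift True j w) / sqrt (real j * sig2)" for j w
  let ?ps = "\<lambda>n w. proxy_shift (n div 2) (window n) w"
  let ?L1 = "\<lambda>n. expectation (\<lambda>w. exp (- (c' n * real_of_int \<bar>?ps n w\<bar>)))"
  let ?L2 = "\<lambda>n. expectation (\<lambda>w. exp (- (cn n * \<bar>Z (k n) w\<bar>)))"
  let ?L3 = "\<lambda>n. expectation (\<lambda>w. exp (- (c * \<bar>Z (k n) w\<bar>)))"
  have c: "0 < c" using False mu s by (simp add: c_def)
  have c'0: "0 \<le> c' n" for n using s by (simp add: c'_def)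
  have Zm[measurable]: "Z j \<in> borel_measurable M" for j unfolding Z_def[abs_def] by measurable
  have pm[measurable]: "(\<lambda>w. real_of_int \<bar>?ps n w\<bar>) \<in> borel_measurable M" for n
    by (rule measurable_compose[OF measurable_proxy_shift]) simp
  have kr: "eventually (\<lambda>n. real (k n) = real_of_int \<lfloor>real n / 2\<rfloor> - real_of_int \<lfloor>real n powr (17/32)\<rfloor>) sequentially"
    using eventually_window[OF mu]
    by eventually_elim (simp add: k_def of_nat_diff flip: real_half real_window)
  have klim: "filterlim k at_top sequentially"
  proof -
    have "filterlim (\<lambda>n. real_of_int \<lfloor>real n / 2\<rfloor> - real_of_int \<lfloor>real n powr (17/32)\<rfloor>) at_top sequentially"
      by real_asymp
    then have "filterlim (\<lambda>n. real (k n)) at_top sequentially"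
      using filterlim_cong[OF refl refl kr] by simp
    then show ?thesis by (simp add: filterlim_sequentially_iff_filterlim_real)
  qed
  have E1: "cmod (expectation (\<lambda>w. iexp (t * limit_proxy n w)) - complex_of_real (?L1 n))
      \<le> 2 * real (window n) * ((\<bar>t\<bar> / 2 * real n powr (-1/4))^3 / 6 + (\<bar>t\<bar> / 2 * real n powr (-1/4))^4 / 8)"
    if n: "1 \<le> n" "window n \<le> n div 2" for n
  proof -
    \<comment> \<open>The factor n^(-1/4)/2 of \<open>limit_proxy\<close> is moved into the argument
      of the characteristic function; u^2 \<open>sig2\<close> / 2 is then c' n.\<close>
    define u where "u = t * (real n powr (-1/4) / 2)"
    have au: "\<bar>u\<bar> = \<bar>t\<bar> / 2 * real n powr (-1/4)" by (simp add: u_def abs_mult)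
    have "(real n powr (-1/4))\<^sup>2 = 1 / sqrt (real n)"
      using n(1) by (simp add: powr_power powr_minus powr_half_sqrt[symmetric] field_simps)
    then have "u\<^sup>2 * sig2 / 2 = c' n" by (simp add: u_def c'_def power_mult_distrib power_divide field_simps)
    then have e: "u\<^sup>2 * (x * sig2) / 2 = c' n * x" for x by (simp add: field_simps)
    have "u ^ 4 = \<bar>u\<bar> ^ 4" by (simp add: power_even_abs)
    then show ?thesis
      using char_swap_inc[OF n(2), of u] unfolding e au[symmetric]
      by (simp add: limit_proxy_def u_def mult_ac)
  qed
  have E2: "\<bar>?L1 n - ?L2 n\<bar> \<le> c' n + 2 * prob (bad_event n)"
    if n: "1 \<le> n" "1 \<le> window n" "window n < n div 2" "(2 + 2 * (real n powr (1/64) * sqrt n)) / (2 * mu) + 1 \<le> real (window n)" for n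
  proof -
    have cn0: "0 \<le> cn n" unfolding cn_def using c'0 mu s by simp
    have "norm (?L1 n - ?L2 n) \<le> c' n + 2 * prob (bad_event n)"
    proof (rule expectation_diff_le)
      fix w assume w: "w \<in> space M" "w \<notin> bad_event n"
      define x where "x = drift False (k n) w - drift True (k n) w"
      have D: "root_mod n (real n powr (1/64)) (\<lambda>x. drift b x w)" for b
        using w by (auto simp: bad_event_def smooth_drift_def root_mod_def)
      have "k n \<le> n" by (simp add: k_def)
      then have "\<bar>drift b (k n) w\<bar> \<le> real n powr (1/64) * sqrt n" for b
        using root_modD[OF D[of b], of "k n" 0 n] by (simp add: drift_def)
      from this[of True] this[of False] have "\<bar>x\<bar> \<le> 2 * (real n powr (1/64) * sqrt n)" by (simp add: x_def)
      then have "\<bar>x / (2 * mu)\<bar> \<le> (2 + 2 * (real n powr (1/64) * sqrt n)) / (2 * mu)"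
        using mu by (simp add: abs_mult divide_right_mono)
      then have xb: "\<bar>x / (2 * mu)\<bar> \<le> real (window n) - 1" using n(4) by linarith
      have "- int (window n) \<le> \<lfloor>x / (2 * mu)\<rfloor>" "\<lfloor>x / (2 * mu)\<rfloor> \<le> int (window n)" using xb by linarith+
      then have "?ps n w = \<lfloor>x / (2 * mu)\<rfloor>"
        by (simp add: proxy_shift_def clamp_shift_def x_def k_def)
      \<comment> \<open>Rounding moves the displacement by at most 1, which is multiplied by c' n of
        order n^(-1/2).\<close>
      then have "\<bar>real_of_int (?ps n w) - x / (2 * mu)\<bar> \<le> 1" by linarith
      then have d1: "\<bar>real_of_int \<bar>?ps n w\<bar> - \<bar>x / (2 * mu)\<bar>\<bar> \<le> 1" by linarith
      have kpos: "0 < k n" using n(3) by (simp add: k_def)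
      then have "sqrt (real (k n) * sig2) * \<bar>Z (k n) w\<bar> = \<bar>x\<bar>"
        using s by (simp add: Z_def x_def abs_divide)
      then have e: "cn n * \<bar>Z (k n) w\<bar> = c' n * \<bar>x / (2 * mu)\<bar>"
        using mu by (simp add: cn_def abs_divide abs_mult mult.assoc)
      have "\<bar>exp (- (c' n * real_of_int \<bar>?ps n w\<bar>)) - exp (- (c' n * \<bar>x / (2 * mu)\<bar>))\<bar>
         \<le> \<bar>c' n * real_of_int \<bar>?ps n w\<bar> - c' n * \<bar>x / (2 * mu)\<bar>\<bar>"
        by (rule abs_exp_minus_diff) (use c'0 in auto)
      also have "\<dots> = c' n * \<bar>real_of_int \<bar>?ps n w\<bar> - \<bar>x / (2 * mu)\<bar>\<bar>"
        using c'0[of n] by (simp only: right_diff_distrib[symmetric] abs_mult abs_of_nonneg)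
      also have "\<dots> \<le> c' n * 1" by (rule mult_left_mono[OF d1 c'0])
      finally show "norm (exp (- (c' n * real_of_int \<bar>?ps n w\<bar>)) - exp (- (cn n * \<bar>Z (k n) w\<bar>))) \<le> c' n"
        unfolding e by simp
    qed (use c'0[of n] cn0 n(1) in \<open>auto intro!: mult_nonneg_nonneg\<close>)
    then show ?thesis by simp
  qed
  have E3: "\<bar>?L2 n - ?L3 n\<bar> \<le> \<bar>cn n - c\<bar> / (c / 2)" if "c / 2 \<le> cn n" for n
  proof -
    have "norm (?L2 n - ?L3 n) \<le> \<bar>cn n - c\<bar> / (c / 2) + 2 * prob {}"
    proof (rule expectation_diff_le)
      fix w
      show "norm (exp (- (cn n * \<bar>Z (k n) w\<bar>)) - exp (- (c * \<bar>Z (k n) w\<bar>))) \<le> \<bar>cn n - c\<bar> / (c / 2)"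
        using abs_exp_minus_scale_diff[of "c / 2" "cn n" c "\<bar>Z (k n) w\<bar>"] c that by simp
    qed (use c that in \<open>auto intro!: mult_nonneg_nonneg divide_nonneg_nonneg\<close>)
    then show ?thesis by simp
  qed
  have cnlim: "cn \<longlonglongrightarrow> c"
  proof -
    have "(\<lambda>n. sqrt (real_of_int \<lfloor>real n / 2\<rfloor> - real_of_int \<lfloor>real n powr (17/32)\<rfloor>) / sqrt (real n)) \<longlonglongrightarrow> (1 / 2) powr (1 / 2)"
      by real_asymp
    moreover have "eventually (\<lambda>n. sqrt (real_of_int \<lfloor>real n / 2\<rfloor> - real_of_int \<lfloor>real n powr (17/32)\<rfloor>) / sqrt (real n) = sqrt (real (k n)) / sqrt (real n)) sequentially"
      using kr by eventually_elim simp
    ultimately have "(\<lambda>n. sqrt (real (k n)) / sqrt (real n)) \<longlonglongrightarrow> (1 / 2) powr (1 / 2)"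
      by (rule Lim_transform_eventually)
    then have "(\<lambda>n. t\<^sup>2 * sig2 * sqrt sig2 / (16 * mu) * (sqrt (real (k n)) / sqrt (real n)))
       \<longlonglongrightarrow> t\<^sup>2 * sig2 * sqrt sig2 / (16 * mu) * sqrt (1 / 2)"
      by (intro tendsto_intros) (simp add: powr_half_sqrt)
    moreover have "t\<^sup>2 * sig2 * sqrt sig2 / (16 * mu) * (sqrt (real (k n)) / sqrt (real n)) = cn n" for n
      by (simp add: cn_def c'_def real_sqrt_mult ac_simps)
    moreover have "t\<^sup>2 * sig2 * sqrt sig2 / (16 * mu) * sqrt (1 / 2) = c"
    proof -
      \<comment> \<open>Here 128 = 8^2 * 2. The 1/2 under the root is the limit of k n / n; together
        with the factor 1/2 in c, 8 mu gives the denominator 16 mu = 8 * (2 mu) of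
        \<open>cn n\<close>.\<close>
      have "sig2 ^ 3 / (128 * mu\<^sup>2) = (sig2 / (8 * mu))\<^sup>2 * sig2 * (1 / 2)"
        by (simp add: power2_eq_square power3_eq_cube)
      then have "sqrt (sig2 ^ 3 / (128 * mu\<^sup>2)) = sig2 / (8 * mu) * sqrt sig2 * sqrt (1 / 2)"
        using s mu by (simp only: real_sqrt_mult real_sqrt_abs) simp
      then show ?thesis by (simp add: c_def)
    qed
    ultimately show ?thesis by simp
  qed
  have T1: "(\<lambda>n. expectation (\<lambda>w. iexp (t * limit_proxy n w)) - complex_of_real (?L1 n)) \<longlonglongrightarrow> 0"
  proof (rule Lim_null_comparison)
    show "\<forall>\<^sub>F n in sequentially. norm (expectation (\<lambda>w. iexp (t * limit_proxy n w)) - complex_of_real (?L1 n))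
       \<le> 2 * real (window n) * ((\<bar>t\<bar> / 2 * real n powr (-1/4))^3 / 6 + (\<bar>t\<bar> / 2 * real n powr (-1/4))^4 / 8)"
      using eventually_window[OF mu] by eventually_elim (intro E1, auto)
    show "(\<lambda>n. 2 * real (window n) * ((\<bar>t\<bar> / 2 * real n powr (-1/4))^3 / 6 + (\<bar>t\<bar> / 2 * real n powr (-1/4))^4 / 8)) \<longlonglongrightarrow> 0"
      unfolding real_window by (rule char_error_asymptotics) (use False in simp)
  qed
  have T2: "(\<lambda>n. ?L1 n - ?L2 n) \<longlonglongrightarrow> 0"
  proof (rule Lim_null_comparison)
    have "eventually (\<lambda>n. real (window n) + 2 \<le> real n / 2) sequentially"
      unfolding real_window by real_asymp
    with eventually_window[OF mu]
    show "\<forall>\<^sub>F n in sequentially. norm (?L1 n - ?L2 n) \<le> c' n + 2 * prob (bad_event n)"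
    proof eventually_elim
      case (elim n)
      then have "2 * window n + 4 \<le> n" by linarith
      then have "window n < n div 2" by linarith
      then show ?case using E2[of n] elim by simp
    qed
    have "c' \<longlonglongrightarrow> 0" unfolding c'_def[abs_def] by (rule inverse_sqrt_asymptotics)
    from tendsto_add[OF this tendsto_mult_right_zero[OF prob_bad_event_tendsto_0, of 2]]
    show "(\<lambda>n. c' n + 2 * prob (bad_event n)) \<longlonglongrightarrow> 0" by simp
  qed
  have T3: "(\<lambda>n. ?L2 n - ?L3 n) \<longlonglongrightarrow> 0"
  proof (rule Lim_null_comparison)
    have "eventually (\<lambda>n. c / 2 < cn n) sequentially"
      using order_tendstoD(1)[OF cnlim, of "c / 2"] c by simp
    then show "\<forall>\<^sub>F n in sequentially. norm (?L2 n - ?L3 n) \<le> \<bar>cn n - c\<bar> / (c / 2)"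
      by eventually_elim (use E3 in simp)
    show "(\<lambda>n. \<bar>cn n - c\<bar> / (c / 2)) \<longlonglongrightarrow> 0"
      using tendsto_divide[OF tendsto_rabs[OF tendsto_diff[OF cnlim tendsto_const[of c]]] tendsto_const[of "c / 2"]] c by simp
  qed
  have T4: "?L3 \<longlonglongrightarrow> (LINT x|std_normal_distribution. exp (- (c * \<bar>x\<bar>)))"
    using filterlim_compose[OF drift_difference_Laplace[OF s less_imp_le[OF c]] klim] by (simp add: Z_def)
  have "?L1 \<longlonglongrightarrow> (LINT x|std_normal_distribution. exp (- (c * \<bar>x\<bar>)))"
    using tendsto_add[OF tendsto_add[OF T2 T3] T4] by simp
  from tendsto_add[OF T1 tendsto_of_real[OF this, where 'a=complex]]
  have "(\<lambda>n. expectation (\<lambda>w. iexp (t * limit_proxy n w))) \<longlonglongrightarrow> complex_of_real (LINT x|std_normal_distribution. exp (- (c * \<bar>x\<bar>)))"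
    by simp
  also have "complex_of_real (LINT x|std_normal_distribution. exp (- (c * \<bar>x\<bar>))) = char (mixF (sig2 ^ 3 / (128 * mu\<^sup>2))) t"
    unfolding char_mixF integral_complex_of_real[symmetric]
    using s by (intro Bochner_Integration.integral_cong refl) (simp add: c_def mult_ac)
  finally show ?thesis .
qed

text \<open>By Levy's theorem characteristic functions suffice. Those of the scaled difference and
  of \<open>limit_proxy\<close> differ by at most |t| times the path error plus twice the
  probability of the bad event, and both vanish.\<close>

theorem greedy_minus_alternating_weak_conv:
  assumes mu: "0 < mu" and s: "0 < sig2" and F0: "F0 \<subseteq> sets M"
    and G: "greedy_policy M F0 r s LR LS CG" and A: "alternating_policy M F0 LR LS CA"
  shows "weak_conv_m (\<lambda>n. distr M borel (\<lambda>w. (real (matches LR LS CG n w) - real (matches LR LS CA n w)) / real n powr (5/4)))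
           (mixF (sig2 ^ 3 / (128 * mu\<^sup>2)))"
proof (rule levy_continuity)
  let ?Y = "\<lambda>n w. (real (matches LR LS CG n w) - real (matches LR LS CA n w)) / real n powr (5/4)"
  have "reading_policy M F0 LR LS CG" "reading_policy M F0 LR LS CA"
    using G A by (simp_all add: greedy_policy_def alternating_policy_def)
  then have Rm: "Rcnt CG n \<in> measurable M (count_space UNIV)" "Rcnt CA n \<in> measurable M (count_space UNIV)" for n
    using reading_policy_measurable[OF _ F0 measurable_LR measurable_LS] by auto
  have [measurable]: "matches LR LS CG n \<in> measurable M (count_space UNIV)" "matches LR LS CA n \<in> measurable M (count_space UNIV)" for n
    using matches_measurable[OF Rm(1) measurable_LR measurable_LS] matches_measurable[OF Rm(2) measurable_LR measurable_LS] by auto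
  have Ym[measurable]: "?Y n \<in> borel_measurable M" for n by measurable
  show "real_distribution (distr M borel (?Y n))" for n by (rule real_distribution_distr) simp
  show "real_distribution (mixF (sig2 ^ 3 / (128 * mu\<^sup>2)))" by (rule real_distribution_mixF)
  fix t
  have c: "char (distr M borel (?Y n)) t = expectation (\<lambda>w. iexp (t * ?Y n w))" for n
    unfolding char_def by (subst integral_distr) auto
  have "(\<lambda>n. expectation (\<lambda>w. iexp (t * ?Y n w)) - expectation (\<lambda>w. iexp (t * limit_proxy n w))) \<longlonglongrightarrow> 0"
  proof (rule Lim_null_comparison)
    show "\<forall>\<^sub>F n in sequentially. norm (expectation (\<lambda>w. iexp (t * ?Y n w)) - expectation (\<lambda>w. iexp (t * limit_proxy n w)))
       \<le> \<bar>t\<bar> * \<bar>path_error n\<bar> + 2 * prob (bad_event n)"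
      using eventually_window[OF mu]
    proof eventually_elim
      case (elim n)
      show ?case
      proof (rule expectation_diff_le)
        fix w assume w: "w \<in> space M" "w \<notin> bad_event n"
        have "cmod (iexp (t * ?Y n w) - iexp (t * limit_proxy n w)) \<le> \<bar>t * ?Y n w - t * limit_proxy n w\<bar>"
          by (rule norm_iexp_diff)
        also have "\<dots> = \<bar>t\<bar> * \<bar>?Y n w - limit_proxy n w\<bar>" by (simp only: right_diff_distrib[symmetric] abs_mult)
        also have "\<dots> \<le> \<bar>t\<bar> * \<bar>path_error n\<bar>"
          using match_difference_close[OF mu G A _ _ _ _ w] elim by (intro mult_left_mono) auto
        finally show "cmod (iexp (t * ?Y n w) - iexp (t * limit_proxy n w)) \<le> \<bar>t\<bar> * \<bar>path_error n\<bar>" .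
      qed (use elim in auto)
    qed
    from tendsto_add[OF tendsto_mult_right_zero[OF tendsto_rabs_zero[OF path_error_tendsto_0[OF mu]], of "\<bar>t\<bar>"]
        tendsto_mult_right_zero[OF prob_bad_event_tendsto_0, of 2]]
    show "(\<lambda>n. \<bar>t\<bar> * \<bar>path_error n\<bar> + 2 * prob (bad_event n)) \<longlonglongrightarrow> 0" by simp
  qed
  from tendsto_add[OF this char_limit_proxy[OF mu s, of t]]
  show "(\<lambda>n. char (distr M borel (?Y n)) t) \<longlonglongrightarrow> char (mixF (sig2 ^ 3 / (128 * mu\<^sup>2))) t"
    unfolding c by simp
qed

end

theorem theorem4p2:
  fixes M :: "'a measure" and F0 :: "'a set set"
    and r s :: "nat \<Rightarrow> real"
    and LR LS :: "nat \<Rightarrow> 'a \<Rightarrow> nat"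
    and CG CA :: "nat \<Rightarrow> 'a \<Rightarrow> bool"
  assumes P: "prob_space M"
    and r_nonneg: "\<forall>i. 0 \<le> r i" and r0: "r 0 = 0" and r_sum: "r sums 1"
    and s_nonneg: "\<forall>i. 0 \<le> s i" and s0: "s 0 = 0" and s_sum: "s sums 1"
    and mu_pos: "(\<Sum>i. r i * s i) > 0"
    and LR_rv: "\<forall>n\<ge>1. LR n \<in> measurable M (count_space UNIV)"
    and LS_rv: "\<forall>n\<ge>1. LS n \<in> measurable M (count_space UNIV)"
    and LR_dist: "\<forall>n\<ge>1. \<forall>i. measure M {w \<in> space M. LR n w = i} = r i"
    and LS_dist: "\<forall>n\<ge>1. \<forall>i. measure M {w \<in> space M. LS n w = i} = s i"
    and indep: "prob_space.indep_vars M (\<lambda>_. count_space UNIV)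
                  (\<lambda>(b, n). if b then LR n else LS n) (UNIV \<times> {1..})"
    and F0_alg: "sigma_algebra (space M) F0" and F0_sub: "F0 \<subseteq> sets M"
    and F0_indep: "prob_space.indep_set M F0
                    (sigma_sets (space M)
                      ({LR n -` A \<inter> space M | n A. 1 \<le> n} \<union> {LS n -` A \<inter> space M | n A. 1 \<le> n}))"
    and var_pos: "prob_space.variance M (\<lambda>w. s (LR 1 w)) + prob_space.variance M (\<lambda>w. r (LS 1 w)) > 0"
    and greedy: "greedy_policy M F0 r s LR LS CG"
    and alt: "alternating_policy M F0 LR LS CA"
  shows "weak_conv_m
           (\<lambda>n. distr M borel
              (\<lambda>w. (real (matches LR LS CG n w) - real (matches LR LS CA n w)) / real n powr (5/4)))
           (mixF ((prob_space.variance M (\<lambda>w. s (LR 1 w)) + prob_space.variance M (\<lambda>w. r (LS 1 w))) ^ 3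
                   / (128 * (\<Sum>i. r i * s i) ^ 2)))"
proof -
  interpret prob_space M by (rule P)
  interpret label_streams M r s LR LS
    by unfold_locales (use assms in blast)+
  have E: "expectation (\<lambda>w. s (LR 1 w)) = mu" "expectation (\<lambda>w. r (LS 1 w)) = mu"
    using expectation_law_label[of "(True, 1)"] expectation_law_label[of "(False, 1)"]
    by (simp_all add: label_def law_def)
  \<comment> \<open>Both scores have mean mu, so their variances are the second moments of
    \<open>dev\<close> at position 1.\<close>
  have "variance (\<lambda>w. s (LR 1 w)) = dvar True" "variance (\<lambda>w. r (LS 1 w)) = dvar False"
    unfolding E using expectation_dev_sq[of "(True, 1)"] expectation_dev_sq[of "(False, 1)"]
    by (simp_all add: dev_def cscore_def label_def law_def)
  then have v: "variance (\<lambda>w. s (LR 1 w)) + variance (\<lambda>w. r (LS 1 w)) = sig2" by (simp add: sig2_def)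
  show ?thesis
    using greedy_minus_alternating_weak_conv[OF _ _ F0_sub greedy alt] mu_pos var_pos
    unfolding v mu_def by simp
qed

end
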